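(* Let $p$ be a prime, $X=\Delta_p$, and let $\alpha=c=(c_0,c_1,\dots,c_n,\dots)\in\Delta_p^0$ be an arbitrary topological automorphism of $X$ (acting by multiplication). Then: 1. Let $\xi_1,\xi_2$ be independent random variables with values in $X$ and distributions $\mu_1,\mu_2$, and assume that the conditional distribution of $L_2=\xi_1+\alpha\xi_2$ given $L_1=\xi_1+\xi_2$ is symmetric. Then: (i) If $p>2$ and $c_0\neq p-1$, then $\mu_j=m_K*E_{x_j}$, $j=1,2$, where $K$ is a compact subgroup of $X$ and $x_j\in X$. Moreover, if $c_0=1$, then $\mu_1$ and $\mu_2$ are degenerate distributions. (ii) If $p=2$, $c_0=1$ and $c_1=0$, then $\mu_1$ and $\mu_2$ are degenerate distributions. 2. If either (i) $p>2$ and $c_0=p-1$, or (ii) $p=2$ and $c_0=c_1=1$, then there exist independent random variables $\xi_1,\xi_2$ with values in $X$ and distributions $\mu_1,\mu_2$ such that the conditional distribution of $L_2=\xi_1+\alpha\xi_2$ given $L_1=\xi_1+\xi_2$ is symmetric, whereas $\mu_1\notin I(X)$ and $\mu_2\notin I(X)$.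
   Context: $\Delta_p$ is the compact group of $p$-adic integers, elements written as digit sequences $x=(x_0,x_1,\dots)$, $x_n\in\{0,\dots,p-1\}$, with addition with carries; $\Delta_p^0=\{x\in\Delta_p:x_0\neq0\}$ is the set of invertible $p$-adic integers, and every topological automorphism of $\Delta_p$ is multiplication by an element of $\Delta_p^0$, with which we identify it. $m_K$ is the Haar probability measure of a compact subgroup $K$, $E_x$ the point mass at $x$, and $I(X)$ is the set of idempotent distributions on $X$, i.e. the shifts $m_K*E_x$ of Haar distributions of compact subgroups $K$. The conditional distribution of $L_2$ given $L_1$ is symmetric if it equals the conditional distribution of $-L_2$ given $L_1$. *)

theory Defs
  imports "HOL-Probability.Probability"
begin

text \<open>p-adic integers as digit sequences x = (x_0, x_1, ...), x_n in {0..p-1}.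
  They live inside the product space nat => nat (product topology, discrete nat).\<close>

definition padic :: "nat \<Rightarrow> (nat \<Rightarrow> nat) set" where
  "padic p = {x. \<forall>n. x n < p}"

definition padic_units :: "nat \<Rightarrow> (nat \<Rightarrow> nat) set" where
  "padic_units p = {x \<in> padic p. x 0 \<noteq> 0}"

definition pval :: "nat \<Rightarrow> nat \<Rightarrow> (nat \<Rightarrow> nat) \<Rightarrow> int" where
  "pval p n x = (\<Sum>k<n. int (x k mod p) * int p ^ k)"

text \<open>digit sequence determined by a compatible family of residues f n (mod p^n)\<close>
definition of_res :: "nat \<Rightarrow> (nat \<Rightarrow> int) \<Rightarrow> (nat \<Rightarrow> nat)" where
  "of_res p f = (\<lambda>n. nat ((f (Suc n) mod int p ^ Suc n) div int p ^ n))"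

definition padd :: "nat \<Rightarrow> (nat \<Rightarrow> nat) \<Rightarrow> (nat \<Rightarrow> nat) \<Rightarrow> (nat \<Rightarrow> nat)" where
  "padd p x y = of_res p (\<lambda>n. pval p n x + pval p n y)"

definition pneg :: "nat \<Rightarrow> (nat \<Rightarrow> nat) \<Rightarrow> (nat \<Rightarrow> nat)" where
  "pneg p x = of_res p (\<lambda>n. - pval p n x)"

definition pmul :: "nat \<Rightarrow> (nat \<Rightarrow> nat) \<Rightarrow> (nat \<Rightarrow> nat) \<Rightarrow> (nat \<Rightarrow> nat)" where
  "pmul p x y = of_res p (\<lambda>n. pval p n x * pval p n y)"

definition pzero :: "nat \<Rightarrow> nat" where
  "pzero = (\<lambda>n. 0)"

definition compact_subgroup :: "nat \<Rightarrow> (nat \<Rightarrow> nat) set \<Rightarrow> bool" where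
  "compact_subgroup p K \<longleftrightarrow> K \<subseteq> padic p \<and> compact K \<and> pzero \<in> K \<and>
     (\<forall>x\<in>K. \<forall>y\<in>K. padd p x y \<in> K) \<and> (\<forall>x\<in>K. pneg p x \<in> K)"

definition is_distribution :: "nat \<Rightarrow> (nat \<Rightarrow> nat) measure \<Rightarrow> bool" where
  "is_distribution p \<mu> \<longleftrightarrow> prob_space \<mu> \<and> sets \<mu> = sets borel \<and> emeasure \<mu> (padic p) = 1"

definition is_haar :: "nat \<Rightarrow> (nat \<Rightarrow> nat) set \<Rightarrow> (nat \<Rightarrow> nat) measure \<Rightarrow> bool" where
  "is_haar p K \<nu> \<longleftrightarrow> compact_subgroup p K \<and> prob_space \<nu> \<and> sets \<nu> = sets borel \<and>
     emeasure \<nu> K = 1 \<and> (\<forall>k\<in>K. distr \<nu> borel (padd p k) = \<nu>)"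

definition shift :: "nat \<Rightarrow> (nat \<Rightarrow> nat) measure \<Rightarrow> (nat \<Rightarrow> nat) \<Rightarrow> (nat \<Rightarrow> nat) measure" where
  "shift p \<nu> x = distr \<nu> borel (\<lambda>y. padd p y x)"

definition idempotent_distrs :: "nat \<Rightarrow> (nat \<Rightarrow> nat) measure set" where
  "idempotent_distrs p = {\<mu>. \<exists>K \<nu> x. is_haar p K \<nu> \<and> x \<in> padic p \<and> \<mu> = shift p \<nu> x}"

definition degenerate :: "nat \<Rightarrow> (nat \<Rightarrow> nat) measure \<Rightarrow> bool" where
  "degenerate p \<mu> \<longleftrightarrow> (\<exists>x\<in>padic p. \<mu> = return borel x)"

definition rv :: "nat \<Rightarrow> 'a measure \<Rightarrow> ('a \<Rightarrow> nat \<Rightarrow> nat) \<Rightarrow> bool" where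
  "rv p M \<xi> \<longleftrightarrow> \<xi> \<in> measurable M borel \<and> (\<forall>\<omega>\<in>space M. \<xi> \<omega> \<in> padic p)"

definition cond_symmetric ::
  "nat \<Rightarrow> 'a measure \<Rightarrow> ('a \<Rightarrow> nat \<Rightarrow> nat) \<Rightarrow> ('a \<Rightarrow> nat \<Rightarrow> nat) \<Rightarrow> bool" where
  "cond_symmetric p M L1 L2 \<longleftrightarrow> (\<forall>B\<in>sets borel.
     AE \<omega> in M. real_cond_exp M (vimage_algebra (space M) L1 borel)
                   (indicator (L2 -` B \<inter> space M)) \<omega>
               = real_cond_exp M (vimage_algebra (space M) L1 borel)
                   (indicator ((\<lambda>\<omega>. pneg p (L2 \<omega>)) -` B \<inter> space M)) \<omega>)"

definition setting ::
  "nat \<Rightarrow> (nat \<Rightarrow> nat) \<Rightarrow> 'a measure \<Rightarrow> ('a \<Rightarrow> nat \<Rightarrow> nat) \<Rightarrow> ('a \<Rightarrow> nat \<Rightarrow> nat) \<Rightarrow> bool" where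
  "setting p c M \<xi>1 \<xi>2 \<longleftrightarrow> prob_space M \<and> rv p M \<xi>1 \<and> rv p M \<xi>2 \<and>
     prob_space.indep_var M borel \<xi>1 borel \<xi>2 \<and>
     cond_symmetric p M (\<lambda>\<omega>. padd p (\<xi>1 \<omega>) (\<xi>2 \<omega>))
                        (\<lambda>\<omega>. padd p (\<xi>1 \<omega>) (pmul p c (\<xi>2 \<omega>)))"

end

theory Submission
  imports Defs "HOL-Number_Theory.Number_Theory" "HOL-Library.Real_Mod"
begin

text \<open>Conditional symmetry says that \<open>(L\<^sub>1, L\<^sub>2)\<close> and \<open>(L\<^sub>1, -L\<^sub>2)\<close> are identically
  distributed. For the characteristic functions \<open>f\<close>, \<open>g\<close> of \<open>\<xi>\<^sub>1\<close>, \<open>\<xi>\<^sub>2\<close> modulo \<open>p\<^sup>n\<close> this is the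
  equation \<open>f(a + b) g(a + cb) = f(a - b) g(a - cb)\<close>, and \<open>a = cb\<close> and \<open>a = b\<close> give
  \<open>f((1 + c)b) g(2cb) = f((c - 1)b)\<close> and \<open>f(2b) g((1 + c)b) = g((1 - c)b)\<close>.
  If \<open>c - 1\<close> is divisible by \<open>p\<close> (by 4 when \<open>p = 2\<close>), then the right-hand side of the first
  equation lives on a lower level, and \<open>|f| = |g| = 1\<close> follows by induction on the level. If
  \<open>c - 1\<close> and \<open>c + 1\<close> are units, then \<open>|f|\<close> does not decrease under multiplication by
  \<open>(1 + c)/(c - 1)\<close>, a unit of finite order modulo \<open>p\<^sup>n\<close>; hence \<open>|f|\<close> is invariant under it, and
  the equations force \<open>|f|\<close> and \<open>|g|\<close> to be indicators of the same subgroup of the dual group.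

  For the converse, a distribution with a biased leading digit and independent uniform further
  digits works: the involution of pairs that fixes \<open>L\<^sub>1\<close> and negates \<open>L\<^sub>2\<close> is integral, and modulo
  \<open>p\<close> it just swaps the two coordinates.\<close>

section \<open>Truncation of digit sequences to residues modulo powers of \<open>p\<close>\<close>

lemma pval_0 [simp]: "pval p 0 x = 0"
  by (simp add: pval_def)

lemma pval_Suc: "pval p (Suc n) x = pval p n x + int (x n mod p) * int p ^ n"
  by (simp add: pval_def)

lemma pval_bounds:
  assumes "p > 0"
  shows "0 \<le> pval p n x" "pval p n x < int p ^ n"
proof (induction n)
  case (Suc n)
  have "int (x n mod p) \<le> int p - 1"
    using assms by (simp add: of_nat_mod)
  then have "int (x n mod p) * int p ^ n \<le> (int p - 1) * int p ^ n"
    by (intro mult_right_mono) auto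
  then show "pval p (Suc n) x < int p ^ Suc n"
    using Suc by (simp add: pval_Suc algebra_simps)
qed (auto simp: pval_Suc)

lemma pval_mod [simp]: "p > 0 \<Longrightarrow> pval p n x mod int p ^ n = pval p n x"
  using pval_bounds[of p n x] by simp

lemma pval_diff_dvd: "m \<le> n \<Longrightarrow> int p ^ m dvd pval p n x - pval p m x"
proof (induction n rule: dec_induct)
  case (step n)
  have "int p ^ m dvd int (x n mod p) * int p ^ n"
    using step by (intro dvd_mult le_imp_power_dvd)
  then have "int p ^ m dvd (pval p n x - pval p m x) + int (x n mod p) * int p ^ n"
    using step by (intro dvd_add) auto
  then show ?case by (simp add: pval_Suc algebra_simps)
qed auto

lemma pval_mod_le: "p > 0 \<Longrightarrow> m \<le> n \<Longrightarrow> pval p n x mod int p ^ m = pval p m x"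
  using pval_diff_dvd[of m n p x] pval_mod[of p m x] by (metis mod_eq_dvd_iff)

lemma pval_cong: "(\<And>k. k < n \<Longrightarrow> x k mod p = y k mod p) \<Longrightarrow> pval p n x = pval p n y"
  by (simp add: pval_def)

text \<open>Reduction passes the equality to all shorter truncations, and two consecutive
  truncations determine the digit between them.\<close>

lemma pval_eq_iff:
  assumes "p > 0"
  shows "pval p n x = pval p n y \<longleftrightarrow> (\<forall>k<n. x k mod p = y k mod p)"
proof (intro iffI allI impI)
  fix k assume eq: "pval p n x = pval p n y" and "k < n"
  have e: "pval p m x = pval p m y" if "m \<le> n" for m
    using eq pval_mod_le[OF assms that, of x] pval_mod_le[OF assms that, of y] by simp
  have "pval p (Suc k) x = pval p (Suc k) y" "pval p k x = pval p k y"
    using \<open>k < n\<close> by (auto intro!: e)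
  then show "x k mod p = y k mod p"
    using assms by (simp add: pval_Suc)
qed (auto intro: pval_cong)

text \<open>Reduces identities between p-adic integers to congruences of integers.\<close>

lemma padic_eqI:
  assumes "x \<in> padic p" "y \<in> padic p" "\<And>n. pval p n x = pval p n y"
  shows "x = y"
proof
  fix k
  have "p > 0" using assms(1) by (cases p) (auto simp: padic_def)
  then have "x k mod p = y k mod p"
    using assms(3)[of "Suc k"] pval_eq_iff by blast
  then show "x k = y k" using assms(1,2) by (simp add: padic_def)
qed

lemma int_div_less: "0 < b \<Longrightarrow> a < b * c \<Longrightarrow> a div b < (c :: int)"
  by (smt (verit) mult_le_cancel_left_pos mult_div_mod_eq pos_mod_sign)

lemma of_res_padic:
  assumes "p > 0"
  shows "of_res p f \<in> padic p"
proof -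
  have "(f (Suc n) mod int p ^ Suc n) div int p ^ n < int p" for n
  proof -
    have "f (Suc n) mod int p ^ Suc n < int p ^ n * int p"
      using assms by (simp add: mult.commute)
    then show ?thesis
      using assms by (intro int_div_less) auto
  qed
  then have "nat (f (Suc n) mod int p ^ Suc n div int p ^ n) < p" for n
    using assms nat_mono_iff[of "int p" "f (Suc n) mod int p ^ Suc n div int p ^ n"] by simp
  then show ?thesis by (simp add: padic_def of_res_def)
qed

text \<open>The congruences say that the family lies in the inverse limit. Digit \<open>n\<close> is
  the quotient of the residue modulo \<open>p ^ Suc n\<close> by \<open>p ^ n\<close>; the remainder
  of that division is the residue modulo \<open>p ^ n\<close>, which the induction hypothesis
  covers.\<close>

lemma pval_of_res:
  assumes "p > 0" "\<And>n. [f (Suc n) = f n] (mod int p ^ n)"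
  shows "pval p n (of_res p f) = f n mod int p ^ n"
proof (induction n)
  case (Suc n)
  let ?r = "f (Suc n) mod int p ^ Suc n"
  have d: "0 \<le> ?r div int p ^ n" using assms(1) by (simp add: pos_imp_zdiv_nonneg_iff)
  have "of_res p f n mod p = of_res p f n"
    using of_res_padic[OF assms(1)] by (simp add: padic_def)
  then have "int (of_res p f n mod p) = ?r div int p ^ n"
    using d by (simp add: of_res_def)
  moreover have "?r mod int p ^ n = f n mod int p ^ n"
    using assms(2)[of n] by (simp add: mod_mod_cancel cong_def)
  ultimately show ?case
    using Suc mod_mult_div_eq[of ?r "int p ^ n"] by (simp only: pval_Suc mult.commute)
qed simp

lemma pval_step_cong: "[pval p (Suc n) x = pval p n x] (mod int p ^ n)"
  using pval_diff_dvd[of n "Suc n" p x] by (simp add: cong_iff_dvd_diff)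

lemma pval_padd: "p > 0 \<Longrightarrow> pval p n (padd p x y) = (pval p n x + pval p n y) mod int p ^ n"
  unfolding padd_def by (rule pval_of_res) (auto intro!: cong_add pval_step_cong)

lemma pval_pneg: "p > 0 \<Longrightarrow> pval p n (pneg p x) = - pval p n x mod int p ^ n"
  unfolding pneg_def
  by (rule pval_of_res) (auto simp: cong_minus_minus_iff intro!: pval_step_cong)

lemma pval_pmul: "p > 0 \<Longrightarrow> pval p n (pmul p x y) = (pval p n x * pval p n y) mod int p ^ n"
  unfolding pmul_def by (rule pval_of_res) (auto intro!: cong_mult pval_step_cong)

lemma pval_pzero [simp]: "pval p n pzero = 0"
  by (simp add: pval_def pzero_def)

lemma pzero_padic: "p > 0 \<Longrightarrow> pzero \<in> padic p"
  by (simp add: padic_def pzero_def)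

lemma padd_padic: "p > 0 \<Longrightarrow> padd p x y \<in> padic p"
  and pneg_padic: "p > 0 \<Longrightarrow> pneg p x \<in> padic p"
  by (simp_all add: padd_def pneg_def of_res_padic)

lemma padd_pzero: "x \<in> padic p \<Longrightarrow> p > 0 \<Longrightarrow> padd p pzero x = x"
  by (intro padic_eqI[of _ p]) (auto simp: padd_padic pval_padd)

subsection \<open>Measurability and uniqueness\<close>

lemma measurable_borel_iff_count_space:
  fixes f :: "'a \<Rightarrow> 'b :: {countable, t2_space}"
  shows "f \<in> measurable M borel \<longleftrightarrow> f \<in> measurable M (count_space UNIV)"
  by (rule arg_cong[where f = "\<lambda>S. f \<in> S"], rule measurable_cong_sets)
     (simp_all add: sets_borel_eq_count_space)

lemma measurable_count_space_binary:
  fixes f :: "'a \<Rightarrow> 'b :: countable" and g :: "'a \<Rightarrow> 'c :: countable"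
  assumes "f \<in> measurable M (count_space UNIV)" "g \<in> measurable M (count_space UNIV)"
  shows "(\<lambda>x. h (f x) (g x)) \<in> measurable M (count_space UNIV)"
  by (rule measurable_compose_countable[OF measurable_compose[OF assms(2)] assms(1)]) simp

lemma measurable_digit [measurable]:
  "(\<lambda>x. x k) \<in> measurable (borel :: (nat \<Rightarrow> nat) measure) (count_space UNIV)"
  unfolding measurable_borel_iff_count_space[symmetric]
  by (intro borel_measurable_continuous_onI continuous_on_product_coordinates)

lemma measurable_pval [measurable]: "pval p n \<in> measurable borel (count_space UNIV)"
proof (induction n)
  case (Suc n)
  then show ?case
    using measurable_count_space_binary[OF Suc measurable_digit[of n],
        of "\<lambda>v d. v + int (d mod p) * int p ^ n"]
    by (simp add: pval_Suc[abs_def])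
qed simp

text \<open>Each digit is a function of a single countably valued residue. Addition, negation and
  multiplication are all of this form.\<close>

lemma measurable_of_res:
  assumes "\<And>n. f n \<in> measurable M (count_space UNIV)"
  shows "(\<lambda>x. of_res p (\<lambda>n. f n x)) \<in> measurable M borel"
proof (rule measurable_coordinatewise_then_product)
  fix i
  have "(\<lambda>x. nat (f (Suc i) x mod int p ^ Suc i div int p ^ i)) \<in> measurable M (count_space UNIV)"
    by (rule measurable_compose[OF assms]) simp
  then show "(\<lambda>x. of_res p (\<lambda>n. f n x) i) \<in> borel_measurable M"
    by (simp add: of_res_def measurable_borel_iff_count_space)
qed

lemma measurable_padd [measurable (raw)]:
  "f \<in> measurable M borel \<Longrightarrow> g \<in> measurable M borel \<Longrightarrow> (\<lambda>x. padd p (f x) (g x)) \<in> measurable M borel"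
  unfolding padd_def by (intro measurable_of_res measurable_count_space_binary[where h = "(+)"]; measurable)

lemma measurable_pneg [measurable (raw)]:
  "f \<in> measurable M borel \<Longrightarrow> (\<lambda>x. pneg p (f x)) \<in> measurable M borel"
  unfolding pneg_def
  by (intro measurable_of_res measurable_count_space_binary[where h = "\<lambda>v _ :: int. - v"]; measurable)

lemma measurable_pmul [measurable (raw)]:
  "f \<in> measurable M borel \<Longrightarrow> g \<in> measurable M borel \<Longrightarrow> (\<lambda>x. pmul p (f x) (g x)) \<in> measurable M borel"
  unfolding pmul_def by (intro measurable_of_res measurable_count_space_binary[where h = "(*)"]; measurable)

lemma sets_padic [measurable]: "padic p \<in> sets borel"
  unfolding padic_def by measurable

text \<open>Cylinders over finitely many digits determine a finite measure. Inside
  \<open>padic p\<close> such a cylinder is a union of residue classes modulo \<open>p ^ n\<close>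
  once \<open>n\<close> exceeds the digit positions involved. The restriction to
  \<open>padic p\<close> matters because \<open>pval\<close> cannot separate digits that agree
  modulo \<open>p\<close>.\<close>

lemma padic_measure_eqI:
  assumes p: "p > 0" and fin: "finite_measure P"
    and sets [measurable_cong]: "sets P = sets borel" "sets Q = sets borel"
    and ae: "AE x in P. x \<in> padic p" "AE x in Q. x \<in> padic p"
    and eq: "\<And>n j. emeasure P {x. pval p n x = j} = emeasure Q {x. pval p n x = j}"
  shows "P = Q"
proof (rule measure_eqI_PiM_infinite[where I = UNIV and M = "\<lambda>_. borel"])
  have sp: "space P = UNIV" "space Q = UNIV"
    using sets by (auto dest: sets_eq_imp_space_eq)
  fix A :: "nat \<Rightarrow> nat set" and J :: "nat set"
  assume "finite J"
  then obtain n where n: "J \<subseteq> {..<n}"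
    by (meson finite_nat_iff_bounded)
  define E where "E = prod_emb UNIV (\<lambda>_. borel) J (Pi\<^sub>E J A)"
  have E: "x \<in> E \<longleftrightarrow> (\<forall>i\<in>J. x i \<in> A i)" for x
    by (auto simp: E_def prod_emb_def PiE_iff)
  \<comment> \<open>The residues met by the cylinder; on \<open>padic p\<close> the cylinder is
    their preimage.\<close>
  define S where "S = pval p n ` (E \<inter> padic p)"
  have *: "x \<in> E \<longleftrightarrow> pval p n x \<in> S" if x: "x \<in> padic p" for x
  proof
    assume "pval p n x \<in> S"
    then obtain y where y: "y \<in> E" "y \<in> padic p" "pval p n x = pval p n y"
      by (auto simp: S_def)
    then have "x k = y k" if "k < n" for k
      using that x pval_eq_iff[OF p, of n x y] by (simp add: padic_def)
    then show "x \<in> E" using y(1) n by (force simp: E)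
  qed (use x in \<open>auto simp: S_def\<close>)
  have Em [measurable]: "E \<in> sets borel"
  proof -
    have "E = (\<Inter>i\<in>J. {x. x i \<in> A i}) \<inter> UNIV" using E by auto
    moreover have "(\<lambda>x. x i) -` A i \<inter> space borel \<in> sets borel" for i
      by (rule measurable_sets[OF measurable_digit]) simp
    then have "{x. x i \<in> A i} \<in> sets borel" for i by (simp add: vimage_def)
    ultimately show ?thesis using \<open>finite J\<close> by (cases "J = {}") (auto intro!: sets.finite_INT)
  qed
  have level: "emeasure R E = emeasure (distr R (count_space UNIV) (pval p n)) S"
    if [measurable_cong]: "sets R = sets borel" and ae: "AE x in R. x \<in> padic p" for R
  proof -
    have sp: "space R = UNIV" using that(1) by (auto dest: sets_eq_imp_space_eq)
    have "emeasure R E = emeasure R (pval p n -` S \<inter> space R)"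
      using ae * measurable_sets[OF measurable_pval[of p n], of S]
      by (intro emeasure_eq_AE) (auto simp: sp that(1))
    then show ?thesis by (simp add: emeasure_distr)
  qed
  have "distr P (count_space UNIV) (pval p n) = distr Q (count_space UNIV) (pval p n)"
    by (rule measure_eqI_countable[where A = UNIV])
       (use eq[of n] in \<open>auto simp: emeasure_distr sp vimage_def\<close>)
  then show "emeasure P (prod_emb UNIV (\<lambda>_. borel) J (Pi\<^sub>E J A))
      = emeasure Q (prod_emb UNIV (\<lambda>_. borel) J (Pi\<^sub>E J A))"
    using level[OF sets(1) ae(1)] level[OF sets(2) ae(2)] by (simp add: E_def)
qed (use fin sets in \<open>simp_all add: sets_PiM_equal_borel\<close>)

subsection \<open>Characters\<close>

text \<open>For positive \<open>N\<close>, the standard character of the integers modulo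
  \<open>N\<close>.\<close>

definition chi :: "int \<Rightarrow> int \<Rightarrow> complex" where
  "chi N t = cis (2 * pi * (real_of_int t / real_of_int N))"

lemma chi_0 [simp]: "chi N 0 = 1"
  by (simp add: chi_def)

lemma chi_add: "chi N (s + t) = chi N s * chi N t"
  by (simp add: chi_def cis_mult add_divide_distrib distrib_left)

lemma chi_power: "chi N (int k * t) = chi N t ^ k"
  unfolding chi_def Complex.DeMoivre by (rule arg_cong[where f = cis]) simp

lemma norm_chi [simp]: "norm (chi N t) = 1"
  by (simp add: chi_def)

lemma chi_eq_1_iff:
  assumes "N > 0"
  shows "chi N t = 1 \<longleftrightarrow> N dvd t"
proof -
  have "chi N t = 1 \<longleftrightarrow> (\<exists>k. real_of_int t / real_of_int N = real_of_int k)"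
  proof -
    have "2 * pi * x = y * (2 * pi) \<longleftrightarrow> x = y" for x y :: real
      by (metis mult.commute mult_cancel_left pi_neq_zero zero_neq_numeral mult_eq_0_iff)
    then show ?thesis unfolding chi_def cis_eq_1_iff by (simp only:)
  qed
  also have "\<dots> \<longleftrightarrow> (\<exists>k. t = k * N)"
  proof (rule arg_cong[where f = Ex], rule ext)
    fix k
    have "real_of_int t / real_of_int N = real_of_int k \<longleftrightarrow> real_of_int t = real_of_int (k * N)"
      using assms by (simp add: divide_eq_eq)
    then show "(real_of_int t / real_of_int N = real_of_int k) = (t = k * N)"
      by (simp only: of_int_eq_iff)
  qed
  finally show ?thesis by (auto simp: dvd_def mult.commute)
qed

lemma chi_cong: "N > 0 \<Longrightarrow> [s = t] (mod N) \<Longrightarrow> chi N s = chi N t"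
  using chi_add[of N t "s - t"] chi_eq_1_iff[of N "s - t"] by (simp add: cong_iff_dvd_diff)

lemma chi_eq_iff: "N > 0 \<Longrightarrow> chi N s = chi N t \<longleftrightarrow> [s = t] (mod N)"
  using chi_add[of N t "s - t"] chi_eq_1_iff[of N "s - t"] norm_chi[of N t] norm_zero
  by (fastforce simp: cong_iff_dvd_diff)

lemma chi_scale: "K \<noteq> 0 \<Longrightarrow> chi (N * K) (t * K) = chi N t"
  by (simp add: chi_def)

text \<open>A geometric sum whose ratio is an \<open>N\<close>-th root of unity, equal to 1 exactly
  when \<open>N\<close> divides \<open>t\<close>.\<close>

lemma sum_chi:
  assumes "N > 0"
  shows "(\<Sum>a<N. chi (int N) (int a * t)) = (if int N dvd t then of_nat N else 0)"
proof (cases "int N dvd t")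
  case True
  then have "chi (int N) (int a * t) = 1" for a
    using assms chi_eq_1_iff[of "int N"] by (simp del: of_nat_mult)
  then show ?thesis using True by simp
next
  case False
  then have "chi (int N) t \<noteq> 1" using assms chi_eq_1_iff[of "int N"] by simp
  moreover have "chi (int N) t ^ N = 1"
    using assms chi_eq_1_iff[of "int N"] by (simp flip: chi_power)
  ultimately show ?thesis
    using False by (simp add: chi_power geometric_sum)
qed

section \<open>Characteristic functions of distributions\<close>

text \<open>The characters of the p-adic integers correspond to fractions \<open>a / p ^ n\<close>
  modulo 1. This is the characteristic function at that fraction, which sees \<open>x\<close> only
  through its residue modulo \<open>p ^ n\<close>.\<close>

definition cf :: "nat \<Rightarrow> (nat \<Rightarrow> nat) measure \<Rightarrow> nat \<Rightarrow> int \<Rightarrow> complex" where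
  "cf p \<mu> n a = (\<integral>x. chi (int p ^ n) (a * pval p n x) \<partial>\<mu>)"

lemma is_distributionD:
  assumes "is_distribution p \<mu>"
  shows "prob_space \<mu>" "sets \<mu> = sets borel" "space \<mu> = UNIV" "AE x in \<mu>. x \<in> padic p"
proof -
  interpret prob_space \<mu> using assms by (simp add: is_distribution_def)
  show s: "prob_space \<mu>" "sets \<mu> = sets borel"
    using assms by (simp_all add: is_distribution_def)
  then show "space \<mu> = UNIV" by (auto dest: sets_eq_imp_space_eq)
  have "prob (padic p) = 1"
    using assms by (simp add: is_distribution_def measure_def)
  then show "AE x in \<mu>. x \<in> padic p"
    using prob_eq_1[of "padic p"] sets_padic[of p] s by auto
qed

lemma measurable_chi_pval:
  "sets \<mu> = sets borel \<Longrightarrow> (\<lambda>x. chi N (a * pval p n x)) \<in> borel_measurable \<mu>"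
  by (subst measurable_cong_sets[OF _ refl], assumption)
     (rule measurable_compose[OF measurable_pval], simp)

lemma integrable_chi_pval:
  assumes "is_distribution p \<mu>"
  shows "integrable \<mu> (\<lambda>x. chi N (a * pval p n x))"
proof -
  interpret prob_space \<mu> using is_distributionD[OF assms] by simp
  show ?thesis
    by (rule integrable_const_bound[where B = 1])
       (auto intro!: measurable_chi_pval is_distributionD[OF assms])
qed

lemma cf_0:
  assumes "is_distribution p \<mu>"
  shows "cf p \<mu> n 0 = 1"
proof -
  interpret prob_space \<mu> using is_distributionD[OF assms] by simp
  show ?thesis by (simp add: cf_def prob_space)
qed

lemma norm_cf_le_1:
  assumes "is_distribution p \<mu>"
  shows "norm (cf p \<mu> n a) \<le> 1"
proof -
  interpret prob_space \<mu> using is_distributionD[OF assms] by simp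
  have "norm (cf p \<mu> n a) \<le> (\<integral>x. norm (chi (int p ^ n) (a * pval p n x)) \<partial>\<mu>)"
    unfolding cf_def by (rule integral_norm_bound)
  then show ?thesis by (simp add: prob_space)
qed

lemma cf_cong: "p > 0 \<Longrightarrow> [a = b] (mod int p ^ n) \<Longrightarrow> cf p \<mu> n a = cf p \<mu> n b"
  unfolding cf_def by (intro Bochner_Integration.integral_cong refl chi_cong cong_mult) auto

text \<open>The fraction with numerator \<open>p ^ k * u\<close> and denominator
  \<open>p ^ n\<close> cancels to \<open>u / p ^ (n - k)\<close>.\<close>

lemma cf_lower_level:
  assumes "p > 0" "k \<le> n"
  shows "cf p \<mu> n (int p ^ k * u) = cf p \<mu> (n - k) u"
  unfolding cf_def
proof (intro Bochner_Integration.integral_cong refl)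
  fix x
  have "chi (int p ^ n) (int p ^ k * u * pval p n x)
      = chi (int p ^ (n - k) * int p ^ k) ((u * pval p n x) * int p ^ k)"
    using assms by (simp add: algebra_simps flip: power_add)
  also have "\<dots> = chi (int p ^ (n - k)) (u * pval p n x)"
    using assms by (intro chi_scale) auto
  also have "\<dots> = chi (int p ^ (n - k)) (u * pval p (n - k) x)"
    using assms pval_diff_dvd[of "n - k" n p x]
    by (intro chi_cong cong_mult) (auto simp: cong_iff_dvd_diff)
  finally show "chi (int p ^ n) (int p ^ k * u * pval p n x)
      = chi (int p ^ (n - k)) (u * pval p (n - k) x)" .
qed

text \<open>Equality case of the triangle inequality. With \<open>m\<close> the mean,
  \<open>1 - Re (cnj m * Z x)\<close> is nonnegative and has integral 0, and a complex number of
  modulus 1 and real part 1 is 1.\<close>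

lemma norm_integral_eq_1_imp_AE_const:
  fixes Z :: "'a \<Rightarrow> complex"
  assumes "prob_space M" and Z: "Z \<in> borel_measurable M" "\<And>x. norm (Z x) = 1"
    and eq: "norm (\<integral>x. Z x \<partial>M) = 1"
  shows "AE x in M. Z x = (\<integral>x. Z x \<partial>M)"
proof -
  interpret prob_space M by fact
  define m where "m = (\<integral>x. Z x \<partial>M)"
  have int: "integrable M Z"
    by (rule integrable_const_bound[where B = 1]) (use Z in auto)
  then have int': "integrable M (\<lambda>x. Re (cnj m * Z x))"
    by (intro integrable_Re integrable_mult_right)
  have m: "m * cnj m = 1"
    using eq by (simp add: complex_norm_square[symmetric] m_def)
  have "(\<integral>x. Re (cnj m * Z x) \<partial>M) = Re (cnj m * m)"
    using int by (subst integral_Re) (auto simp: m_def)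
  then have "(\<integral>x. 1 - Re (cnj m * Z x) \<partial>M) = 0"
    using int' m by (simp add: prob_space mult.commute)
  moreover have le: "Re (cnj m * Z x) \<le> 1" for x
    using complex_Re_le_cmod[of "cnj m * Z x"] eq Z(2)[of x] by (simp add: norm_mult m_def del: times_complex.sel)
  ultimately have "AE x in M. 1 - Re (cnj m * Z x) = 0"
    using int' by (subst (asm) integral_nonneg_eq_0_iff_AE) (auto simp del: times_complex.sel)
  then show ?thesis
  proof (eventually_elim)
    case (elim x)
    have "norm (cnj m * Z x) = 1" using eq Z(2)[of x] by (simp add: norm_mult m_def)
    then have "cnj m * Z x = 1"
      using elim by (simp add: complex_eq_iff cmod_def del: times_complex.sel)
    then have "m * cnj m * Z x = m" by (simp only: mult.assoc mult_1_right)
    then show "Z x = (\<integral>x. Z x \<partial>M)" unfolding m by (simp add: m_def)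
  qed
qed

text \<open>Modulus 1 forces the character to be almost surely constant, and for a numerator prime
  to \<open>p\<close> the character is injective on residues modulo \<open>p ^ n\<close>.\<close>

lemma norm_cf_eq_1_iff:
  assumes "prime p" and \<mu>: "is_distribution p \<mu>" and b: "coprime b (int p)"
  shows "norm (cf p \<mu> n b) = 1 \<longleftrightarrow> (\<exists>r. AE x in \<mu>. pval p n x = r)"
proof
  interpret prob_space \<mu> using is_distributionD[OF \<mu>] by simp
  have p: "p > 0" using assms(1) prime_gt_0_nat by auto
  {
    assume "norm (cf p \<mu> n b) = 1"
    then have ae: "AE x in \<mu>. chi (int p ^ n) (b * pval p n x) = cf p \<mu> n b"
      unfolding cf_def
      by (intro norm_integral_eq_1_imp_AE_const prob_space_axioms measurable_chi_pval is_distributionD[OF \<mu>] norm_chi)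
    have "\<exists>y. chi (int p ^ n) (b * pval p n y) = cf p \<mu> n b"
      by (intro eventually_happens'[OF _ ae]) (simp add: ae_filter_eq_bot_iff emeasure_space_1)
    then obtain y where y: "chi (int p ^ n) (b * pval p n y) = cf p \<mu> n b" by auto
    have "AE x in \<mu>. pval p n x = pval p n y"
      using ae
    proof eventually_elim
      case (elim x)
      then have "[b * pval p n x = b * pval p n y] (mod int p ^ n)"
        using y p by (subst chi_eq_iff[symmetric]) auto
      then have "[pval p n x = pval p n y] (mod int p ^ n)"
        using b by (subst (asm) cong_mult_lcancel) auto
      then show ?case using p by (simp add: cong_def)
    qed
    then show "\<exists>r. AE x in \<mu>. pval p n x = r" by blast
  }
  {
    assume "\<exists>r. AE x in \<mu>. pval p n x = r"
    then obtain r where r: "AE x in \<mu>. pval p n x = r" by auto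
    have "cf p \<mu> n b = (\<integral>x. chi (int p ^ n) (b * r) \<partial>\<mu>)"
      unfolding cf_def using r
      by (intro integral_cong_AE) (auto intro!: measurable_chi_pval is_distributionD[OF \<mu>])
    then show "norm (cf p \<mu> n b) = 1" by (simp add: prob_space)
  }
qed

text \<open>Fourier inversion on the integers modulo \<open>p ^ n\<close>: summing under the
  integral, orthogonality of characters leaves the indicator of one residue class.\<close>

lemma cf_inversion:
  assumes p: "p > 0" and \<mu>: "is_distribution p \<mu>" and j: "0 \<le> j" "j < int p ^ n"
  shows "(\<Sum>a<p ^ n. cf p \<mu> n (int a) * chi (int p ^ n) (- int a * j))
    = of_nat (p ^ n) * of_real (measure \<mu> {x. pval p n x = j})"
proof -
  interpret prob_space \<mu> using is_distributionD[OF \<mu>] by simp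
  have meas: "{x. pval p n x = j} \<in> sets \<mu>"
    using measurable_sets[OF measurable_pval[of p n], of "{j}"] is_distributionD[OF \<mu>]
    by (simp add: vimage_def)
  have "(\<Sum>a<p ^ n. cf p \<mu> n (int a) * chi (int p ^ n) (- int a * j))
      = (\<integral>x. (\<Sum>a<p ^ n. chi (int p ^ n) (int a * pval p n x) * chi (int p ^ n) (- int a * j)) \<partial>\<mu>)"
    unfolding cf_def
    by (subst Bochner_Integration.integral_sum) (auto intro!: integrable_chi_pval[OF \<mu>])
  also have "\<dots> = (\<integral>x. of_real (real (p ^ n) * indicator {x. pval p n x = j} x) \<partial>\<mu>)"
  proof (intro Bochner_Integration.integral_cong refl)
    fix x
    have "(\<Sum>a<p ^ n. chi (int p ^ n) (int a * pval p n x) * chi (int p ^ n) (- int a * j))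
        = (\<Sum>a<p ^ n. chi (int (p ^ n)) (int a * (pval p n x - j)))"
      by (simp add: right_diff_distrib flip: chi_add)
    also have "\<dots> = (if int (p ^ n) dvd pval p n x - j then of_nat (p ^ n) else 0)"
      using p by (intro sum_chi) auto
    also have "int (p ^ n) dvd pval p n x - j \<longleftrightarrow> pval p n x = j"
      using j pval_bounds[OF p, of n x] by (simp flip: mod_eq_dvd_iff)
    finally show "(\<Sum>a<p ^ n. chi (int p ^ n) (int a * pval p n x) * chi (int p ^ n) (- int a * j))
        = of_real (real (p ^ n) * indicator {x. pval p n x = j} x)"
      by simp
  qed
  also have "\<dots> = of_nat (p ^ n) * of_real (measure \<mu> {x. pval p n x = j})"
    unfolding integral_complex_of_real using meas by (simp add: is_distributionD[OF \<mu>])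
  finally show ?thesis .
qed

text \<open>Inversion recovers the mass of every residue class at every level, and these masses
  determine the distribution.\<close>

lemma cf_eqI:
  assumes p: "p > 0" and P: "is_distribution p P" and Q: "is_distribution p Q"
    and eq: "\<And>n a. cf p P n a = cf p Q n a"
  shows "P = Q"
proof (rule padic_measure_eqI[OF p])
  interpret P: prob_space P using is_distributionD[OF P] by simp
  interpret Q: prob_space Q using is_distributionD[OF Q] by simp
  show "finite_measure P" by unfold_locales
  fix n j
  show "emeasure P {x. pval p n x = j} = emeasure Q {x. pval p n x = j}"
  proof (cases "0 \<le> j \<and> j < int p ^ n")
    case True
    then have "measure P {x. pval p n x = j} = measure Q {x. pval p n x = j}"
      using cf_inversion[OF p P, of j n] cf_inversion[OF p Q, of j n] p by (simp add: eq)
    then show ?thesis by (simp add: P.emeasure_eq_measure Q.emeasure_eq_measure)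
  next
    case False
    then have "{x. pval p n x = j} = {}" using pval_bounds[OF p, of n] by auto
    then show ?thesis by simp
  qed
qed (use is_distributionD[OF P] is_distributionD[OF Q] in auto)

lemma is_distribution_distr:
  assumes p: "p > 0" and "prob_space M" "X \<in> measurable M borel" "\<And>\<omega>. \<omega> \<in> space M \<Longrightarrow> X \<omega> \<in> padic p"
  shows "is_distribution p (distr M borel X)"
proof -
  interpret prob_space M by fact
  have "X -` padic p \<inter> space M = space M" using assms by auto
  then have "emeasure (distr M borel X) (padic p) = 1"
    using assms by (simp add: emeasure_distr sets_padic emeasure_space_1)
  then show ?thesis
    using assms by (simp add: is_distribution_def prob_space_distr)
qed

lemma cf_distr:
  assumes "X \<in> measurable M borel"
  shows "cf p (distr M borel X) n a = (\<integral>\<omega>. chi (int p ^ n) (a * pval p n (X \<omega>)) \<partial>M)"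
  unfolding cf_def using assms by (intro integral_distr measurable_chi_pval) auto

lemma cf_distr_padd:
  assumes p: "p > 0" and \<mu>: "is_distribution p \<mu>"
  shows "cf p (distr \<mu> borel (\<lambda>y. padd p y x)) n a = cf p \<mu> n a * chi (int p ^ n) (a * pval p n x)"
proof -
  have "(\<lambda>y. padd p y x) \<in> measurable \<mu> borel"
    by (subst measurable_cong_sets[OF _ refl], rule is_distributionD[OF \<mu>]) measurable
  then have "cf p (distr \<mu> borel (\<lambda>y. padd p y x)) n a
      = (\<integral>y. chi (int p ^ n) (a * pval p n (padd p y x)) \<partial>\<mu>)"
    by (rule cf_distr)
  also have "\<dots> = (\<integral>y. chi (int p ^ n) (a * pval p n y) * chi (int p ^ n) (a * pval p n x) \<partial>\<mu>)"
  proof (intro Bochner_Integration.integral_cong refl)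
    fix y
    have "[a * pval p n (padd p y x) = a * (pval p n y + pval p n x)] (mod int p ^ n)"
      using p by (intro cong_mult) (simp_all add: pval_padd)
    then show "chi (int p ^ n) (a * pval p n (padd p y x))
        = chi (int p ^ n) (a * pval p n y) * chi (int p ^ n) (a * pval p n x)"
      using p by (simp add: chi_cong distrib_left flip: chi_add)
  qed
  finally show ?thesis by (simp add: cf_def)
qed

lemma padd_commute: "padd p x y = padd p y x"
  by (simp add: padd_def add.commute)

lemma is_distribution_distr_padd:
  assumes "p > 0" "is_distribution p \<mu>"
  shows "is_distribution p (distr \<mu> borel (\<lambda>y. padd p y x))"
  using assms
  by (intro is_distribution_distr is_distributionD[OF assms(2)] padd_padic
      measurable_cong_sets[THEN equalityD1, THEN subsetD, of borel \<mu> borel borel])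
    (auto simp: is_distributionD[OF assms(2)])

subsection \<open>Conditional symmetry and the functional equation\<close>

text \<open>A conditional expectation is characterised by its integrals over the sets of
  \<open>F\<close>; for an indicator these are the measures of intersections.\<close>

lemma (in finite_measure_subalgebra) real_cond_exp_indicator_eq_iff:
  assumes U: "U \<in> sets M" and V: "V \<in> sets M"
  shows "(AE x in M. real_cond_exp M F (indicator U) x = real_cond_exp M F (indicator V) x)
    \<longleftrightarrow> (\<forall>A\<in>sets F. measure M (A \<inter> U) = measure M (A \<inter> V))"
proof
  have int: "integrable M (indicator W :: _ \<Rightarrow> real)" if "W \<in> sets M" for W
    using that by (simp add: integrable_real_indicator less_top[symmetric])
  have AM: "A \<in> sets M" if "A \<in> sets F" for A
    using that subalg by (auto simp: subalgebra_def)
  have ind: "(\<integral>x\<in>A. indicator W x \<partial>M) = measure M (A \<inter> W)" if "A \<in> sets F" "W \<in> sets M" for A W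
  proof -
    have "(\<integral>x\<in>A. indicator W x \<partial>M) = (\<integral>x. indicator (A \<inter> W) x \<partial>M :: real)"
      by (simp add: set_lebesgue_integral_def indicator_inter_arith)
    then show ?thesis
      using AM[OF that(1)] that(2) sets.sets_into_space[OF that(2)]
      by (simp add: Int_absorb2 le_infI2)
  qed
  note ce = real_cond_exp_int(1)[OF int]
  {
    assume ae: "AE x in M. real_cond_exp M F (indicator U) x = real_cond_exp M F (indicator V) x"
    show "\<forall>A\<in>sets F. measure M (A \<inter> U) = measure M (A \<inter> V)"
    proof
      fix A assume A: "A \<in> sets F"
      have "(\<integral>x\<in>A. real_cond_exp M F (indicator U) x \<partial>M) = (\<integral>x\<in>A. real_cond_exp M F (indicator V) x \<partial>M)"
        unfolding set_lebesgue_integral_def using ae AM[OF A] ce[OF U] ce[OF V]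
        by (intro integral_cong_AE) (auto intro!: borel_measurable_scaleR)
      then show "measure M (A \<inter> U) = measure M (A \<inter> V)"
        using A U V by (simp add: ind int flip: real_cond_exp_intA)
    qed
  }
  {
    assume eq: "\<forall>A\<in>sets F. measure M (A \<inter> U) = measure M (A \<inter> V)"
    show "AE x in M. real_cond_exp M F (indicator U) x = real_cond_exp M F (indicator V) x"
    proof (rule real_cond_exp_charact)
      fix A assume A: "A \<in> sets F"
      show "(\<integral>x\<in>A. indicator U x \<partial>M) = (\<integral>x\<in>A. real_cond_exp M F (indicator V) x \<partial>M)"
        using eq A U V by (simp add: ind int flip: real_cond_exp_intA)
    qed (use U V int ce in auto)
  }
qed

text \<open>The sets of the sigma-algebra generated by \<open>L1\<close> are the preimages of Borel
  sets, so conditional symmetry becomes equality of the joint laws of \<open>(L1, L2)\<close> and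
  \<open>(L1, -L2)\<close> on rectangles.\<close>

lemma cond_symmetric_iff:
  assumes M: "prob_space M" and L1 [measurable]: "L1 \<in> measurable M borel" and L2 [measurable]: "L2 \<in> measurable M borel"
  shows "cond_symmetric p M L1 L2 \<longleftrightarrow> (\<forall>B\<in>sets borel. \<forall>A\<in>sets borel.
    measure M (L1 -` A \<inter> space M \<inter> (L2 -` B \<inter> space M))
      = measure M (L1 -` A \<inter> space M \<inter> ((\<lambda>\<omega>. pneg p (L2 \<omega>)) -` B \<inter> space M)))"
proof -
  interpret prob_space M by fact
  let ?F = "vimage_algebra (space M) L1 borel"
  have sF: "sets ?F = {L1 -` A \<inter> space M | A. A \<in> sets borel}"
    by (rule sets_vimage_algebra2) auto
  interpret finite_measure_subalgebra M ?F
    by unfold_locales (auto simp: subalgebra_def sF)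
  show ?thesis
    unfolding cond_symmetric_def
    by (intro ball_cong refl, subst real_cond_exp_indicator_eq_iff) (auto simp: sF)
qed

lemma settingD:
  assumes "setting p c M X Y"
  shows "prob_space M" "X \<in> measurable M borel" "Y \<in> measurable M borel"
    "\<And>\<omega>. \<omega> \<in> space M \<Longrightarrow> X \<omega> \<in> padic p" "\<And>\<omega>. \<omega> \<in> space M \<Longrightarrow> Y \<omega> \<in> padic p"
    "prob_space.indep_var M borel X borel Y"
    "cond_symmetric p M (\<lambda>\<omega>. padd p (X \<omega>) (Y \<omega>)) (\<lambda>\<omega>. padd p (X \<omega>) (pmul p c (Y \<omega>)))"
  using assms by (auto simp: setting_def rv_def)

text \<open>Both sides are joint characteristic functions at \<open>(a, b)\<close>, of
  \<open>(L1, L2)\<close> and of \<open>(L1, -L2)\<close>. Collecting terms,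
  \<open>a * L1 + b * L2\<close> has coefficients \<open>a + b\<close> at \<open>X\<close> and
  \<open>a + c * b\<close> at \<open>Y\<close>, and independence splits the integral; negating
  \<open>L2\<close> replaces \<open>b\<close> by \<open>- b\<close>.\<close>

lemma heyde_equation:
  fixes n :: nat
  assumes p: "p > 0" and S: "setting p c M X Y"
  defines "f \<equiv> cf p (distr M borel X) n" and "g \<equiv> cf p (distr M borel Y) n"
  shows "f (a + b) * g (a + pval p n c * b) = f (a - b) * g (a - pval p n c * b)"
proof -
  note [measurable] = settingD(2,3)[OF S]
  interpret prob_space M using settingD(1)[OF S] .
  let ?C = "pval p n c"
  let ?N = "int p ^ n"
  define L1 where "L1 \<omega> = padd p (X \<omega>) (Y \<omega>)" for \<omega>
  define L2 where "L2 \<omega> = padd p (X \<omega>) (pmul p c (Y \<omega>))" for \<omega>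
  have [measurable]: "L1 \<in> measurable M borel" "L2 \<in> measurable M borel"
    unfolding L1_def L2_def by measurable
  have sym: "cond_symmetric p M L1 L2"
    using settingD(7)[OF S] by (simp add: L1_def[abs_def] L2_def[abs_def])
  define J where "J Z \<omega> = (pval p n (L1 \<omega>), pval p n (Z \<omega> :: nat \<Rightarrow> nat))" for Z and \<omega>
  have J: "J Z \<in> measurable M (count_space UNIV)" if [measurable]: "Z \<in> measurable M borel" for Z
    unfolding J_def by (intro measurable_count_space_binary[where h = Pair]; measurable)
  have mneg: "(\<lambda>\<omega>. pneg p (L2 \<omega>)) \<in> measurable M borel" by measurable
  \<comment> \<open>Pairs of residues are countably many, so singletons suffice, and each singleton
    has a rectangle as preimage.\<close>
  have "distr M (count_space UNIV) (J L2) = distr M (count_space UNIV) (J (\<lambda>\<omega>. pneg p (L2 \<omega>)))"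
  proof (rule measure_eqI_countable[where A = UNIV])
    fix ij :: "int \<times> int"
    define A where "A = pval p n -` {fst ij}"
    define B where "B = pval p n -` {snd ij}"
    have AB: "A \<in> sets borel" "B \<in> sets borel"
      using measurable_sets[OF measurable_pval] by (auto simp: A_def B_def space_borel)
    have *: "J Z -` {ij} \<inter> space M = L1 -` A \<inter> space M \<inter> (Z -` B \<inter> space M)" for Z
      by (auto simp: J_def A_def B_def)
    show "emeasure (distr M (count_space UNIV) (J L2)) {ij}
        = emeasure (distr M (count_space UNIV) (J (\<lambda>\<omega>. pneg p (L2 \<omega>)))) {ij}"
      using cond_symmetric_iff[of M L1 L2 p] sym AB
      by (simp add: emeasure_distr J mneg * prob_space_axioms emeasure_eq_measure)
  qed auto
  then have "(\<integral>z. chi ?N (a * fst z + b * snd z) \<partial>distr M (count_space UNIV) (J L2))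
      = (\<integral>z. chi ?N (a * fst z + b * snd z) \<partial>distr M (count_space UNIV) (J (\<lambda>\<omega>. pneg p (L2 \<omega>))))"
    by simp
  then have eq: "(\<integral>\<omega>. chi ?N (a * pval p n (L1 \<omega>) + b * pval p n (L2 \<omega>)) \<partial>M)
      = (\<integral>\<omega>. chi ?N (a * pval p n (L1 \<omega>) + b * pval p n (pneg p (L2 \<omega>))) \<partial>M)"
    by (subst (asm) (1 2) integral_distr) (auto simp: J mneg J_def)
  have fg: "(\<integral>\<omega>. chi ?N (s * pval p n (X \<omega>)) * chi ?N (t * pval p n (Y \<omega>)) \<partial>M) = f s * g t" for s t
  proof -
    have cm: "(\<lambda>x. chi ?N (s * pval p n x)) \<in> borel_measurable borel" for s
      by (rule measurable_chi_pval) simp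
    have ii: "integrable M (\<lambda>\<omega>. chi ?N (s * pval p n (Z \<omega>)))" if "Z \<in> measurable M borel" for s Z
      by (rule integrable_const_bound[where B = 1]) (auto intro: measurable_compose[OF that cm])
    have "indep_var borel (\<lambda>\<omega>. chi ?N (s * pval p n (X \<omega>))) borel (\<lambda>\<omega>. chi ?N (t * pval p n (Y \<omega>)))"
      using indep_var_compose[OF settingD(6)[OF S] cm cm] by (simp add: comp_def)
    then have "(\<integral>\<omega>. chi ?N (s * pval p n (X \<omega>)) * chi ?N (t * pval p n (Y \<omega>)) \<partial>M)
        = (\<integral>\<omega>. chi ?N (s * pval p n (X \<omega>)) \<partial>M) * (\<integral>\<omega>. chi ?N (t * pval p n (Y \<omega>)) \<partial>M)"
      by (rule indep_var_lebesgue_integral) (auto intro!: ii)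
    then show ?thesis by (simp add: f_def g_def cf_distr)
  qed
  have c1: "[pval p n (L1 \<omega>) = pval p n (X \<omega>) + pval p n (Y \<omega>)] (mod ?N)" for \<omega>
    using p by (simp add: L1_def pval_padd)
  have c2: "[pval p n (L2 \<omega>) = pval p n (X \<omega>) + ?C * pval p n (Y \<omega>)] (mod ?N)" for \<omega>
    using p by (simp add: L2_def pval_padd pval_pmul cong_def mod_simps)
  have c3: "[pval p n (pneg p (L2 \<omega>)) = - pval p n (L2 \<omega>)] (mod ?N)" for \<omega>
    using p by (simp add: pval_pneg)
  have N: "?N > 0" using p by simp
  have "chi ?N (a * pval p n (L1 \<omega>) + b * pval p n (L2 \<omega>))
      = chi ?N ((a + b) * pval p n (X \<omega>)) * chi ?N ((a + ?C * b) * pval p n (Y \<omega>))" for \<omega>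
  proof -
    have "[a * pval p n (L1 \<omega>) + b * pval p n (L2 \<omega>)
        = a * (pval p n (X \<omega>) + pval p n (Y \<omega>)) + b * (pval p n (X \<omega>) + ?C * pval p n (Y \<omega>))] (mod ?N)"
      by (intro cong_add cong_mult cong_refl c1 c2)
    from chi_cong[OF N this] show ?thesis
      by (simp add: algebra_simps flip: chi_add)
  qed
  moreover have "chi ?N (a * pval p n (L1 \<omega>) + b * pval p n (pneg p (L2 \<omega>)))
      = chi ?N ((a - b) * pval p n (X \<omega>)) * chi ?N ((a - ?C * b) * pval p n (Y \<omega>))" for \<omega>
  proof -
    have "[a * pval p n (L1 \<omega>) + b * pval p n (pneg p (L2 \<omega>))
        = a * (pval p n (X \<omega>) + pval p n (Y \<omega>)) + b * - (pval p n (X \<omega>) + ?C * pval p n (Y \<omega>))] (mod ?N)"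
      by (intro cong_add cong_mult cong_refl c1 cong_trans[OF c3]) (simp only: cong_minus_minus_iff c2)
    from chi_cong[OF N this] show ?thesis
      by (simp add: algebra_simps flip: chi_add)
  qed
  ultimately show ?thesis using eq by (simp add: fg)
qed

subsection \<open>Solving the functional equation\<close>

lemma eq_one_of_mult_eq_one:
  fixes x y :: real
  assumes "0 \<le> x" "x \<le> 1" "0 \<le> y" "y \<le> 1" "x * y = 1"
  shows "x = 1" "y = 1"
  using assms mult_left_le[of y x] mult_left_le[of x y] by (simp_all add: mult.commute)

text \<open>Euler's theorem, carried from naturals to integers through the residue \<open>v\<close>
  of \<open>u\<close>.\<close>

lemma ex_power_cong_1:
  fixes u N :: int
  assumes "N > 0" "coprime u N"
  shows "\<exists>k>0. [u ^ k = 1] (mod N)"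
proof -
  define v where "v = nat (u mod N)"
  have v: "int v = u mod N" using assms(1) by (simp add: v_def)
  have "coprime (int v) (int (nat N))" using assms by (simp add: v)
  then have "[v ^ totient (nat N) = 1] (mod nat N)"
    by (intro euler_theorem) (simp only: coprime_int_iff)
  then have "[int v ^ totient (nat N) = 1] (mod N)"
    using assms(1) by (simp flip: cong_int_iff)
  then have "[u ^ totient (nat N) = 1] (mod N)"
    by (simp add: v cong_def power_mod)
  then show ?thesis using assms(1) by (intro exI[of _ "totient (nat N)"]) simp
qed

text \<open>The chain \<open>F w \<le> F (u * w) \<le> F (u ^ 2 * w) \<le> ...\<close> returns to
  \<open>F w\<close> once a power of \<open>u\<close> is 1 modulo \<open>N\<close>, so all its terms
  are equal.\<close>

lemma periodic_mono_unit_eq: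
  fixes F :: "int \<Rightarrow> real"
  assumes "N > 0" "coprime u N" and per: "\<And>a b. [a = b] (mod N) \<Longrightarrow> F a = F b"
    and mono: "\<And>w. F w \<le> F (u * w)"
  shows "F (u * w) = F w"
proof -
  obtain k where k: "k > 0" "[u ^ k = 1] (mod N)"
    using ex_power_cong_1[OF assms(1,2)] by auto
  have "F w \<le> F (u ^ j * w)" for j w
  proof (induction j)
    case (Suc j)
    then show ?case using mono[of "u ^ j * w"] by (simp add: mult.assoc)
  qed simp
  \<comment> \<open>From \<open>u * w\<close>, another \<open>k - 1\<close> factors lead to
    \<open>u ^ k * w\<close>, which is congruent to \<open>w\<close>.\<close>
  from this[of "u * w" "k - 1"] have "F (u * w) \<le> F (u ^ k * w)"
    using k(1) by (cases k) (simp_all add: mult_ac)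
  also have "\<dots> = F w"
    using cong_mult[OF k(2) cong_refl, of w] by (intro per) simp
  finally show ?thesis using mono[of w] by simp
qed

text \<open>Induction on \<open>k\<close> over the multiples of \<open>p ^ (n - k)\<close>. On the
  right of the equation the argument carries one more factor \<open>p\<close>, so the value there is
  already known to be 1; two numbers in [0, 1] with product 1 both equal 1, and the unit multipliers
  \<open>r\<close> and \<open>s\<close> can be inverted.\<close>

lemma heyde_all_one:
  fixes F G :: "int \<Rightarrow> real"
  assumes p: "prime (p :: nat)"
    and per: "\<And>a b. [a = b] (mod int p ^ n) \<Longrightarrow> F a = F b" "\<And>a b. [a = b] (mod int p ^ n) \<Longrightarrow> G a = G b"
    and bnd: "\<And>a. 0 \<le> F a" "\<And>a. F a \<le> 1" "\<And>a. 0 \<le> G a" "\<And>a. G a \<le> 1"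
    and one: "F 0 = 1" "G 0 = 1"
    and r: "coprime r (int p)" and s: "coprime s (int p)"
    and eq: "\<And>b. F (r * b) * G (s * b) = F (int p * (t * b))"
  shows "F b = 1" "G b = 1"
proof -
  have unit: "\<exists>u. [v * u = 1] (mod int p ^ n)" if "coprime v (int p)" for v
    using cong_solve_coprime_int[of v "int p ^ n"] that by simp
  obtain r' s' where inv: "[r * r' = 1] (mod int p ^ n)" "[s * s' = 1] (mod int p ^ n)"
    using unit[OF r] unit[OF s] by auto
  have "\<forall>b. F (int p ^ (n - k) * b) = 1 \<and> G (int p ^ (n - k) * b) = 1" if "k \<le> n" for k
    using that
  proof (induction k)
    case 0
    have "[int p ^ n * b = 0] (mod int p ^ n)" for b by (simp add: cong_0_iff)
    then show ?case using per[of _ 0] one by simp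
  next
    case (Suc k)
    let ?q = "int p ^ (n - Suc k)"
    have q: "int p * (t * (?q * b)) = int p ^ (n - k) * (t * b)" for b
      using Suc.prems by (simp add: Suc_diff_Suc[symmetric] mult_ac del: diff_Suc_Suc)
    have prod: "F (r * (?q * b)) = 1" "G (s * (?q * b)) = 1" for b
      using eq_one_of_mult_eq_one[OF bnd, of "r * (?q * b)" "s * (?q * b)"] eq[of "?q * b"] Suc
      by (simp_all add: q)
    \<comment> \<open>Every multiple of \<open>?q\<close> is, modulo \<open>p ^ n\<close>, of the
      form at which \<open>prod\<close> gives the value 1.\<close>
    have "[r * (?q * (r' * b)) = ?q * b] (mod int p ^ n)" "[s * (?q * (s' * b)) = ?q * b] (mod int p ^ n)" for b
      using cong_mult[OF inv(1) cong_refl, of "?q * b"] cong_mult[OF inv(2) cong_refl, of "?q * b"]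
      by (simp_all add: mult_ac)
    then show ?case using prod per by metis
  qed
  from this[of n] show "F b = 1" "G b = 1" by auto
qed

text \<open>Since \<open>G \<le> 1\<close>, \<open>eq1\<close> makes \<open>F\<close> nondecreasing
  under the unit \<open>(1 + c) / (c - 1)\<close>, hence invariant under it; cancelling in
  \<open>eq1\<close> then gives \<open>G = 1\<close> at a unit multiple of any point where
  \<open>F\<close> is nonzero. The same holds with \<open>F\<close> and \<open>G\<close> exchanged,
  by \<open>eq2\<close>. Going back and forth often enough returns to the starting point.\<close>

lemma heyde_zero_one:
  fixes F G :: "int \<Rightarrow> real"
  assumes N: "N > 0"
    and per: "\<And>a b. [a = b] (mod N) \<Longrightarrow> F a = F b" "\<And>a b. [a = b] (mod N) \<Longrightarrow> G a = G b"
    and bnd: "\<And>a. 0 \<le> F a" "\<And>a. F a \<le> 1" "\<And>a. 0 \<le> G a" "\<And>a. G a \<le> 1"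
    and cop: "coprime (1 + c) N" "coprime (c - 1) N" "coprime c N" "coprime 2 N"
    and eq1: "\<And>b. F ((1 + c) * b) * G (2 * c * b) = F ((c - 1) * b)"
    and eq2: "\<And>b. F (2 * b) * G ((1 + c) * b) = G ((1 - c) * b)"
  shows "F b = 0 \<or> F b = 1" "F b = 1 \<Longrightarrow> \<exists>s. coprime s N \<and> G (s * b) = 1"
    "G b = 1 \<Longrightarrow> \<exists>s. coprime s N \<and> F (s * b) = 1"
    "G b = 0 \<or> G b = 1"
proof -
  obtain h where h: "[(1 + c) * h = 1] (mod N)"
    using cong_solve_coprime_int[OF cop(1)] by auto
  obtain i where i: "[(c - 1) * i = 1] (mod N)"
    using cong_solve_coprime_int[OF cop(2)] by auto
  have i': "[(1 - c) * (- i) = 1] (mod N)"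
    using i by (simp add: algebra_simps)
  have coph: "coprime h N" and copi: "coprime i N"
    using h i cong_imp_coprime[OF cong_sym] by (metis coprime_1_left coprime_mult_left_iff)+
  have shift: "[v * (v' * w) = w] (mod N)" if "[v * v' = 1] (mod N)" for v v' w
    using cong_mult[OF that cong_refl, of w] by (simp add: mult_ac)
  have F_inv: "F ((1 + c) * b) = F ((c - 1) * b)" for b
  proof -
    \<comment> \<open>With \<open>i\<close> inverse to \<open>c - 1\<close>, the multiplier is the
      quotient \<open>(1 + c) / (c - 1)\<close> modulo \<open>N\<close>.\<close>
    have le: "F w \<le> F ((1 + c) * i * w)" for w
    proof -
      have "F w = F ((c - 1) * (i * w))"
        by (rule per(1)[OF cong_sym[OF shift[OF i]]])
      also have "\<dots> \<le> F ((1 + c) * (i * w))"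
        unfolding eq1[of "i * w", symmetric] using bnd by (intro mult_left_le) auto
      finally show ?thesis by (simp add: mult.assoc)
    qed
    have "F ((1 + c) * i * ((c - 1) * b)) = F ((c - 1) * b)"
      using cop copi by (intro periodic_mono_unit_eq[where F = F, OF N _ per(1) le]) auto
    moreover have "[(1 + c) * i * ((c - 1) * b) = (1 + c) * b] (mod N)"
      using shift[OF i, of "(1 + c) * b"] by (simp add: mult_ac)
    ultimately show ?thesis using per(1) by metis
  qed
  have G_inv: "G ((1 + c) * b) = G ((1 - c) * b)" for b
  proof -
    have le: "G w \<le> G ((1 + c) * (- i) * w)" for w
    proof -
      have "G w = G ((1 - c) * (- i * w))"
        by (rule per(2)[OF cong_sym[OF shift[OF i']]])
      also have "\<dots> \<le> G ((1 + c) * (- i * w))"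
        unfolding eq2[of "- i * w", symmetric] using bnd by (intro mult_left_le_one_le) auto
      finally show ?thesis by (simp add: mult.assoc)
    qed
    have "G ((1 + c) * (- i) * ((1 - c) * b)) = G ((1 - c) * b)"
      using cop copi by (intro periodic_mono_unit_eq[where F = G, OF N _ per(2) le]) auto
    moreover have "[(1 + c) * (- i) * ((1 - c) * b) = (1 + c) * b] (mod N)"
      using shift[OF i', of "(1 + c) * b"] by (simp add: mult_ac)
    ultimately show ?thesis using per(2) by metis
  qed
  \<comment> \<open>By \<open>F_inv\<close>, the \<open>F\<close> factors on the two sides of
    \<open>eq1\<close> at \<open>h * w\<close> both equal \<open>F w\<close>, which cancels.\<close>
  have FG: "G (2 * c * h * w) = 1" if "F w \<noteq> 0" for w
  proof -
    have "F ((1 + c) * (h * w)) = F w" by (rule per(1)[OF shift[OF h]])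
    then show ?thesis using eq1[of "h * w"] F_inv[of "h * w"] that by (simp add: mult.assoc)
  qed
  have GF: "F (2 * h * w) = 1" if "G w \<noteq> 0" for w
  proof -
    have "G ((1 + c) * (h * w)) = G w" by (rule per(2)[OF shift[OF h]])
    then show ?thesis using eq2[of "h * w"] G_inv[of "h * w"] that by (simp add: mult.assoc)
  qed
  \<comment> \<open>The product of the multipliers of \<open>FG\<close> and \<open>GF\<close>: one
    round trip, from either function, multiplies the argument by \<open>u\<close>.\<close>
  define u where "u = 2 * h * (2 * c * h)"
  have copu: "coprime u N"
    unfolding u_def using cop coph by (simp only: coprime_mult_left_iff simp_thms)
  obtain k where k: "k > 0" "[u ^ k = 1] (mod N)"
    using ex_power_cong_1[OF N copu] by auto
  have step: "F w \<noteq> 0 \<Longrightarrow> F (u * w) = 1" "G w \<noteq> 0 \<Longrightarrow> G (u * w) = 1" for w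
    using GF[OF FG[of w, THEN eq_neq_eq_imp_neq[of _ 1 0 0]]] FG[OF GF[of w, THEN eq_neq_eq_imp_neq[of _ 1 0 0]]]
    by (auto simp: u_def mult_ac)
  have pow: "F w \<noteq> 0 \<Longrightarrow> F (u ^ Suc j * w) = 1" "G w \<noteq> 0 \<Longrightarrow> G (u ^ Suc j * w) = 1" for j w
    by (induction j) (use step in \<open>auto simp: mult.assoc\<close>)
  have "[u ^ k * b = b] (mod N)"
    using cong_mult[OF k(2) cong_refl, of b] by simp
  moreover have "k = Suc (k - 1)" using k(1) by simp
  ultimately show "F b = 0 \<or> F b = 1" "G b = 0 \<or> G b = 1"
    using pow[of b "k - 1"] per by metis+
  show "\<exists>s. coprime s N \<and> G (s * b) = 1" if "F b = 1"
    using FG[of b] that cop coph by (intro exI[of _ "2 * c * h"]) auto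
  show "\<exists>s. coprime s N \<and> F (s * b) = 1" if "G b = 1"
    using GF[of b] that cop coph by (intro exI[of _ "2 * h"]) auto
qed

subsection \<open>Reconstruction of the distributions\<close>

lemma prime_coprime_int_iff: "prime p \<Longrightarrow> coprime a (int p) \<longleftrightarrow> \<not> int p dvd a"
  using prime_imp_coprime[of "int p" a] coprime_absorb_left[of "int p" a]
  by (auto simp: coprime_commute)

lemma ex_padic_of_AE:
  assumes \<mu>: "is_distribution p \<mu>" and "AE x in \<mu>. P x"
  shows "\<exists>x\<in>padic p. P x"
proof -
  interpret prob_space \<mu> using is_distributionD[OF \<mu>] by simp
  have "AE x in \<mu>. x \<in> padic p \<and> P x"
    using assms(2) is_distributionD(4)[OF \<mu>] by auto
  then have "\<exists>x. x \<in> padic p \<and> P x"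
    by (intro eventually_happens') (auto simp add: ae_filter_eq_bot_iff emeasure_space_1)
  then show ?thesis by blast
qed

lemma eq_return_of_AE:
  assumes "prob_space \<mu>" "sets \<mu> = sets borel" "AE y in \<mu>. y = (x :: nat \<Rightarrow> nat)"
  shows "\<mu> = return borel x"
proof (rule measure_eqI)
  interpret prob_space \<mu> by fact
  fix A assume A: "A \<in> sets \<mu>"
  have "emeasure \<mu> A = emeasure \<mu> (if x \<in> A then space \<mu> else {})"
    using assms A by (intro emeasure_eq_AE) auto
  then show "emeasure \<mu> A = emeasure (return borel x) A"
    using A assms(2) by (simp add: emeasure_space_1 split: split_indicator)
qed (use assms in simp)

text \<open>Countably many null sets may be discarded at once, so all residues are simultaneously
  constant almost surely. Some point of \<open>padic p\<close> realises them, and it is determined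
  by its residues.\<close>

lemma degenerateI:
  assumes p: "p > 0" and \<mu>: "is_distribution p \<mu>" and const: "\<And>n. \<exists>r. AE x in \<mu>. pval p n x = r"
  shows "degenerate p \<mu>"
proof -
  obtain r where "\<And>n. AE x in \<mu>. pval p n x = r n"
    using const by metis
  then have ae: "AE x in \<mu>. \<forall>n. pval p n x = r n"
    by (simp add: AE_all_countable)
  then obtain x where x: "x \<in> padic p" "\<And>n. pval p n x = r n"
    using ex_padic_of_AE[OF \<mu>] by auto
  have "AE y in \<mu>. y = x"
    using ae is_distributionD(4)[OF \<mu>] by eventually_elim (auto intro!: padic_eqI[of _ p] x(1) simp: x(2))
  then show ?thesis
    using eq_return_of_AE is_distributionD[OF \<mu>] x(1) by (auto simp: degenerate_def)
qed

text \<open>The subgroup of multiples of \<open>p ^ m\<close>.\<close>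

definition level_subgroup :: "nat \<Rightarrow> nat \<Rightarrow> (nat \<Rightarrow> nat) set" where
  "level_subgroup p m = {x \<in> padic p. pval p m x = 0}"

text \<open>Tychonoff's theorem for the topology of the function type.\<close>

lemma compact_PiE_UNIV:
  fixes S :: "'a \<Rightarrow> 'b :: topological_space set"
  assumes "\<And>i. compact (S i)"
  shows "compact (Pi\<^sub>E UNIV S)"
  using assms compactin_PiE[of "\<lambda>_. euclidean" UNIV S]
  by (simp add: euclidean_product_topology)

text \<open>The first \<open>m\<close> digits vanish and the others are free, so the subgroup is a
  product of finite sets.\<close>

lemma compact_subgroup_level:
  assumes p: "p > 0"
  shows "compact_subgroup p (level_subgroup p m)"
proof -
  have "x \<in> level_subgroup p m \<longleftrightarrow> x \<in> Pi\<^sub>E UNIV (\<lambda>k. if k < m then {0} else {..<p})" for x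
  proof -
    have "x \<in> level_subgroup p m \<longleftrightarrow> (\<forall>k. x k < p) \<and> (\<forall>k<m. x k mod p = 0)"
      using pval_eq_iff[OF p, of m x pzero] unfolding pval_pzero by (simp add: level_subgroup_def padic_def pzero_def)
    also have "\<dots> \<longleftrightarrow> (\<forall>k. x k \<in> (if k < m then {0} else {..<p}))"
      using p by (metis lessThan_iff mod_0 mod_less singletonD singletonI)
    finally show ?thesis by (simp add: PiE_iff)
  qed
  then have "level_subgroup p m = Pi\<^sub>E UNIV (\<lambda>k. if k < m then {0} else {..<p})" by blast
  then have "compact (level_subgroup p m)"
    by (simp add: compact_PiE_UNIV finite_imp_compact)
  then show ?thesis
    using p by (auto simp: compact_subgroup_def level_subgroup_def pzero_padic padd_padic
        pneg_padic pval_padd pval_pneg)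
qed

text \<open>The condition \<^term>\<open>int p ^ n dvd a * int p ^ m\<close> says that the character with numerator
  \<^term>\<open>a\<close> and denominator \<^term>\<open>p ^ n\<close> annihilates \<^term>\<open>level_subgroup p m\<close>.\<close>

lemma cf_eq_char_on_annihilator:
  assumes p: "prime p" and \<mu>: "is_distribution p \<mu>"
    and x: "AE y in \<mu>. pval p m y = pval p m x"
    and zero: "\<And>n u. n > m \<Longrightarrow> coprime u (int p) \<Longrightarrow> cf p \<mu> n u = 0"
  shows "cf p \<mu> n a = (if int p ^ n dvd a * int p ^ m then chi (int p ^ n) (a * pval p n x) else 0)"
proof -
  interpret prob_space \<mu> using is_distributionD[OF \<mu>] by simp
  have p0: "p > 0" using p prime_gt_0_nat by auto
  show ?thesis
  proof (cases "int p ^ n dvd a * int p ^ m")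
    case True
    have "AE y in \<mu>. chi (int p ^ n) (a * pval p n y) = chi (int p ^ n) (a * pval p n x)"
      using x
    proof eventually_elim
      case (elim y)
      \<comment> \<open>For \<open>m \<le> n\<close> the difference is a multiple of
        \<open>p ^ m\<close>, to which the divisibility of \<open>a * p ^ m\<close> applies; for
        smaller \<open>n\<close> the residues coincide.\<close>
      have "int p ^ n dvd a * (pval p n y - pval p n x)"
      proof (cases "m \<le> n")
        case True': True
        have "int p ^ m dvd pval p n y - pval p n x"
          using dvd_diff[OF pval_diff_dvd[OF True', of p y] pval_diff_dvd[OF True', of p x]] elim
          by simp
        then show ?thesis using True by (meson dvd_trans dvd_refl mult_dvd_mono)
      next
        case False
        then have "pval p n y = pval p n x"
          using elim pval_mod_le[OF p0, of n m] by (metis nle_le)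
        then show ?thesis by simp
      qed
      then show ?case
        using p0 by (intro chi_cong) (auto simp: cong_iff_dvd_diff right_diff_distrib)
    qed
    then have "cf p \<mu> n a = (\<integral>y. chi (int p ^ n) (a * pval p n x) \<partial>\<mu>)"
      unfolding cf_def
      by (intro integral_cong_AE) (auto intro!: measurable_chi_pval is_distributionD[OF \<mu>])
    then show ?thesis using True by (simp add: prob_space)
  next
    case False
    then have "a \<noteq> 0" by auto
    moreover have "\<not> is_unit (int p)" using p by auto
    \<comment> \<open>Put the fraction \<open>a / p ^ n\<close> in lowest terms. If its character
      does not annihilate the subgroup, the reduced denominator \<open>p ^ (n - k)\<close> exceeds
      \<open>p ^ m\<close>, and \<open>zero\<close> applies.\<close>
    ultimately obtain k u where u: "\<not> int p dvd u" "a = u * int p ^ k"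
      using multiplicity_decompose'[of a "int p"] by (metis mult.commute)
    have "k + m < n"
    proof (rule ccontr)
      assume "\<not> k + m < n"
      then have "int p ^ n dvd u * int p ^ (k + m)"
        by (intro dvd_mult le_imp_power_dvd) auto
      then show False using False u(2) by (simp add: power_add mult.assoc)
    qed
    moreover have "cf p \<mu> n a = cf p \<mu> (n - k) u"
      using cf_lower_level[OF p0, of k n \<mu> u] \<open>k + m < n\<close> u(2) by (simp add: mult.commute)
    ultimately show ?thesis
      using zero[of "n - k" u] u(1) False by (simp add: prime_coprime_int_iff[OF p])
  qed
qed

text \<open>Translation by \<open>-x\<close> strips the character, leaving the indicator of the
  annihilator of \<open>level_subgroup p m\<close>. A further translation by an element of that
  subgroup multiplies by characters that are trivial on it, so uniqueness of characteristic
  functions gives invariance.\<close>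

lemma haar_of_cf:
  assumes p: "prime p" and \<mu>: "is_distribution p \<mu>" and x: "x \<in> padic p"
    and ae: "AE y in \<mu>. pval p m y = pval p m x"
    and cf: "\<And>n a. cf p \<mu> n a = (if int p ^ n dvd a * int p ^ m then chi (int p ^ n) (a * pval p n x) else 0)"
  defines "\<nu> \<equiv> distr \<mu> borel (\<lambda>y. padd p y (pneg p x))"
  shows "is_haar p (level_subgroup p m) \<nu>" "is_distribution p \<nu>"
    "cf p \<nu> n a = (if int p ^ n dvd a * int p ^ m then 1 else 0)"
proof -
  have p0: "p > 0" using p prime_gt_0_nat by auto
  show \<nu>: "is_distribution p \<nu>"
    unfolding \<nu>_def by (rule is_distribution_distr_padd[OF p0 \<mu>])
  interpret \<nu>: prob_space \<nu> using is_distributionD[OF \<nu>] by simp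
  show cf\<nu>: "cf p \<nu> n a = (if int p ^ n dvd a * int p ^ m then 1 else 0)" for n a
  proof -
    have "[a * pval p n x + a * pval p n (pneg p x) = a * pval p n x + a * - pval p n x] (mod int p ^ n)"
      using p0 by (intro cong_add cong_mult) (simp_all add: pval_pneg)
    then have "chi (int p ^ n) (a * pval p n x) * chi (int p ^ n) (a * pval p n (pneg p x)) = 1"
      using p0 chi_cong[of "int p ^ n"] by (simp flip: chi_add)
    then show ?thesis
      by (simp add: \<nu>_def cf_distr_padd[OF p0 \<mu>] cf)
  qed
  have msets: "level_subgroup p m \<in> sets borel"
    unfolding level_subgroup_def using measurable_sets[OF measurable_pval[of p m], of "{0}"] sets_padic[of p]
    by (simp add: Collect_conj_eq vimage_def)
  have "AE y in \<mu>. padd p y (pneg p x) \<in> level_subgroup p m"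
    using ae by eventually_elim (auto simp: level_subgroup_def padd_padic p0 pval_padd pval_pneg mod_simps)
  then have "AE y in \<nu>. y \<in> level_subgroup p m"
    unfolding \<nu>_def using msets is_distributionD[OF \<mu>]
    by (subst AE_distr_iff) (auto intro!: measurable_padd simp: cong: measurable_cong_sets)
  then have "emeasure \<nu> (level_subgroup p m) = 1"
    using msets is_distributionD[OF \<nu>] by (intro \<nu>.emeasure_eq_1_AE) auto
  moreover have "distr \<nu> borel (padd p k) = \<nu>" if k: "k \<in> level_subgroup p m" for k
  proof -
    have *: "padd p k = (\<lambda>y. padd p y k)" by (simp add: padd_commute fun_eq_iff)
    have "chi (int p ^ n) (a * pval p n k) = 1" if dvd: "int p ^ n dvd a * int p ^ m" for n a
    proof -
      have k0: "pval p m k = 0" using k by (simp add: level_subgroup_def)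
      have "int p ^ n dvd a * pval p n k"
      proof (cases "m \<le> n")
        case True
        have "int p ^ m dvd pval p n k"
          using pval_diff_dvd[OF True, of p k] k0 by simp
        then show ?thesis using dvd by (meson dvd_trans dvd_refl mult_dvd_mono)
      next
        case False
        then have "pval p n k = 0"
          using k0 pval_mod_le[OF p0, of n m k] by simp
        then show ?thesis by simp
      qed
      then show ?thesis using p0 by (simp add: chi_eq_1_iff)
    qed
    then show ?thesis
      unfolding *
      by (intro cf_eqI[OF p0] is_distribution_distr_padd \<nu> p0)
         (simp add: cf_distr_padd[OF p0 \<nu>] cf\<nu>)
  qed
  ultimately show "is_haar p (level_subgroup p m) \<nu>"
    using is_distributionD[OF \<nu>] compact_subgroup_level[OF p0] by (simp add: is_haar_def)
qed

lemma haar_return_pzero: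
  assumes p: "p > 0"
  shows "is_haar p {pzero} (return borel pzero)"
proof -
  have "padd p pzero pzero = pzero" "pneg p pzero = pzero"
    using p by (auto intro!: padic_eqI[of _ p] simp: pzero_padic padd_padic pneg_padic pval_padd pval_pneg)
  moreover have "distr (return borel pzero) borel (padd p pzero) = return borel (padd p pzero pzero)"
    by (rule distr_return) (auto intro!: measurable_padd)
  \<comment> \<open>A countable conjunction of digit conditions, hence a Borel set.\<close>
  moreover have "{pzero} = {x. \<forall>k. x k = pzero k}" by auto
  then have "{pzero} \<in> sets borel" by simp
  then have "emeasure (return borel pzero) {pzero} = 1" by (simp add: emeasure_return)
  ultimately show ?thesis
    using p by (auto simp: is_haar_def compact_subgroup_def pzero_padic prob_space_return)
qed

lemma shift_return_pzero:
  assumes "p > 0" "x \<in> padic p"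
  shows "shift p (return borel pzero) x = return borel x"
proof -
  have "distr (return borel pzero) borel (\<lambda>y. padd p y x) = return borel (padd p pzero x)"
    by (rule distr_return) (auto intro!: measurable_padd)
  then show ?thesis using assms by (simp add: shift_def padd_pzero)
qed

lemma common_haar_of_degenerate:
  assumes p: "p > 0" and deg: "degenerate p \<mu>1" "degenerate p \<mu>2"
  shows "\<exists>K \<nu>. is_haar p K \<nu> \<and> (\<exists>x1\<in>padic p. \<exists>x2\<in>padic p. \<mu>1 = shift p \<nu> x1 \<and> \<mu>2 = shift p \<nu> x2)"
proof -
  obtain x1 where x1: "x1 \<in> padic p" "\<mu>1 = return borel x1"
    using deg(1) by (auto simp: degenerate_def)
  obtain x2 where x2: "x2 \<in> padic p" "\<mu>2 = return borel x2"
    using deg(2) by (auto simp: degenerate_def)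
  have "\<mu>1 = shift p (return borel pzero) x1" "\<mu>2 = shift p (return borel pzero) x2"
    using x1 x2 p by (simp_all add: shift_return_pzero)
  then show ?thesis using haar_return_pzero[OF p] x1(1) x2(1) by blast
qed

definition const_level :: "nat \<Rightarrow> (nat \<Rightarrow> nat) measure \<Rightarrow> nat \<Rightarrow> bool" where
  "const_level p \<mu> n \<longleftrightarrow> (\<exists>r. AE x in \<mu>. pval p n x = r)"

text \<open>Either every level is constant and both distributions are degenerate, or there is a last
  constant level \<open>m\<close>. Beyond it the characteristic functions vanish at reduced
  fractions, so both distributions are translates of the Haar distribution of
  \<open>level_subgroup p m\<close>.\<close>

lemma common_haar:
  assumes p: "prime p" and \<mu>: "is_distribution p \<mu>1" "is_distribution p \<mu>2"
    and same: "\<And>n. const_level p \<mu>1 n \<longleftrightarrow> const_level p \<mu>2 n"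
    and zero: "\<And>n u. coprime u (int p) \<Longrightarrow> \<not> const_level p \<mu>1 n \<Longrightarrow> cf p \<mu>1 n u = 0 \<and> cf p \<mu>2 n u = 0"
  shows "\<exists>K \<nu>. is_haar p K \<nu> \<and> (\<exists>x1\<in>padic p. \<exists>x2\<in>padic p. \<mu>1 = shift p \<nu> x1 \<and> \<mu>2 = shift p \<nu> x2)"
proof -
  have p0: "p > 0" using p prime_gt_0_nat by auto
  show ?thesis
  proof (cases "\<forall>n. const_level p \<mu>1 n")
    case True
    then have "degenerate p \<mu>1" "degenerate p \<mu>2"
      using degenerateI[OF p0 \<mu>(1)] degenerateI[OF p0 \<mu>(2)] same by (auto simp: const_level_def)
    then show ?thesis by (rule common_haar_of_degenerate[OF p0])
  next
    case False
    \<comment> \<open>The first nonconstant level; it is positive because level 0 is always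
      constant.\<close>
    obtain n0 where n0: "\<not> const_level p \<mu>1 n0" and below: "\<And>n. n < n0 \<Longrightarrow> const_level p \<mu>1 n"
      using False exists_least_iff[of "\<lambda>n. \<not> const_level p \<mu>1 n"] by blast
    have "const_level p \<mu>1 0" unfolding const_level_def pval_0 by auto
    then obtain m where m: "n0 = Suc m" using n0 by (cases n0) auto
    have up: "\<not> const_level p \<mu>1 n" if "n > m" for n
    proof
      assume "const_level p \<mu>1 n"
      then obtain r where "AE x in \<mu>1. pval p n x = r" by (auto simp: const_level_def)
      then have "AE x in \<mu>1. pval p n0 x = r mod int p ^ n0"
        by eventually_elim (use pval_mod_le[OF p0, of n0 n] that m in auto)
      then show False using n0 by (auto simp: const_level_def)
    qed
    have c: "const_level p \<mu>1 m" "const_level p \<mu>2 m" using below[of m] m same by auto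
    have ex: "\<exists>x\<in>padic p. AE y in \<mu>. pval p m y = pval p m x"
      if dist: "is_distribution p \<mu>" and lev: "const_level p \<mu> m" for \<mu>
    proof -
      obtain r where r: "AE y in \<mu>. pval p m y = r" using lev by (auto simp: const_level_def)
      then obtain x where "x \<in> padic p" "pval p m x = r" using ex_padic_of_AE[OF dist] by blast
      then show ?thesis using r by blast
    qed
    obtain x1 where x1: "x1 \<in> padic p" "AE y in \<mu>1. pval p m y = pval p m x1"
      using ex[OF \<mu>(1) c(1)] by auto
    obtain x2 where x2: "x2 \<in> padic p" "AE y in \<mu>2. pval p m y = pval p m x2"
      using ex[OF \<mu>(2) c(2)] by auto
    have z: "cf p \<mu>1 n u = 0" "cf p \<mu>2 n u = 0" if "n > m" "coprime u (int p)" for n u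
      using zero[OF that(2) up[OF that(1)]] by auto
    note cf1 = cf_eq_char_on_annihilator[OF p \<mu>(1) x1(2) z(1)]
    note cf2 = cf_eq_char_on_annihilator[OF p \<mu>(2) x2(2) z(2)]
    \<comment> \<open>Centring the first distribution suffices: up to a character the second has the
      same characteristic function, so it is a shift of the same \<open>\<nu>\<close>.\<close>
    define \<nu> where "\<nu> = distr \<mu>1 borel (\<lambda>y. padd p y (pneg p x1))"
    have \<nu>: "is_haar p (level_subgroup p m) \<nu>" "is_distribution p \<nu>"
      "cf p \<nu> n a = (if int p ^ n dvd a * int p ^ m then 1 else 0)" for n a
      unfolding \<nu>_def by (rule haar_of_cf[OF p \<mu>(1) x1 cf1]; assumption)+
    have "\<mu>1 = shift p \<nu> x1" "\<mu>2 = shift p \<nu> x2"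
      unfolding shift_def
      by (intro cf_eqI[OF p0] \<mu> is_distribution_distr_padd \<nu> p0;
          simp add: cf_distr_padd[OF p0 \<nu>(2)] \<nu>(3) cf1 cf2)+
    then show ?thesis using \<nu>(1) x1(1) x2(1) by blast
  qed
qed

subsection \<open>Units not congruent to -1\<close>

locale heyde =
  fixes p :: nat and c :: "nat \<Rightarrow> nat" and M :: "'a measure" and X Y :: "'a \<Rightarrow> nat \<Rightarrow> nat"
  assumes p: "prime p" and c: "c \<in> padic_units p" and S: "setting p c M X Y"
begin

definition "\<mu>1 = distr M borel X"
definition "\<mu>2 = distr M borel Y"

lemma p0: "p > 0"
  using p prime_gt_0_nat by auto

lemma distrib: "is_distribution p \<mu>1" "is_distribution p \<mu>2"
  unfolding \<mu>1_def \<mu>2_def using settingD[OF S] p0 by (auto intro!: is_distribution_distr)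

text \<open>Taking moduli keeps the functional equation, which is multiplicative, and gives
  functions with values in [0, 1].\<close>

definition F :: "nat \<Rightarrow> int \<Rightarrow> real" where "F n a = norm (cf p \<mu>1 n a)"
definition G :: "nat \<Rightarrow> int \<Rightarrow> real" where "G n a = norm (cf p \<mu>2 n a)"

lemma FG_basic:
  "0 \<le> F n a" "F n a \<le> 1" "0 \<le> G n a" "G n a \<le> 1" "F n 0 = 1" "G n 0 = 1"
  using norm_cf_le_1[OF distrib(1)] norm_cf_le_1[OF distrib(2)] cf_0[OF distrib(1)] cf_0[OF distrib(2)]
  by (simp_all add: F_def G_def)

lemma FG_cong:
  "[a = b] (mod int p ^ n) \<Longrightarrow> F n a = F n b" "[a = b] (mod int p ^ n) \<Longrightarrow> G n a = G n b"
  using cf_cong[OF p0] by (simp_all add: F_def G_def)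

lemma FG_lower: "F (Suc n) (int p * a) = F n a" "G (Suc n) (int p * a) = G n a"
  using cf_lower_level[OF p0, of 1 "Suc n"] by (simp_all add: F_def G_def)

lemma FG_equation: "F n (a + b) * G n (a + pval p n c * b) = F n (a - b) * G n (a - pval p n c * b)"
  using heyde_equation[OF p0 S, of n a b] by (simp add: F_def G_def \<mu>1_def \<mu>2_def flip: norm_mult)

text \<open>For \<open>a = c * b\<close> the last factor becomes \<open>G n 0 = 1\<close>.\<close>

lemma FG_equation1:
  "F n ((1 + pval p n c) * b) * G n (2 * pval p n c * b) = F n ((pval p n c - 1) * b)"
  using FG_equation[of n "pval p n c * b" b] FG_basic by (simp add: algebra_simps)

text \<open>For \<open>a = b\<close> the factor \<open>F n (a - b)\<close> becomes
  \<open>F n 0 = 1\<close>.\<close>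

lemma FG_equation2:
  "F n (2 * b) * G n ((1 + pval p n c) * b) = G n ((1 - pval p n c) * b)"
  using FG_equation[of n b b] FG_basic by (simp add: algebra_simps)

lemma const_level_iff:
  "coprime b (int p) \<Longrightarrow> F n b = 1 \<longleftrightarrow> const_level p \<mu>1 n"
  "coprime b (int p) \<Longrightarrow> G n b = 1 \<longleftrightarrow> const_level p \<mu>2 n"
  using norm_cf_eq_1_iff[OF p distrib(1)] norm_cf_eq_1_iff[OF p distrib(2)]
  by (simp_all add: F_def G_def const_level_def)

lemma degenerate_of_norm_cf:
  assumes "\<And>n. F n 1 = 1" "\<And>n. G n 1 = 1"
  shows "degenerate p \<mu>1" "degenerate p \<mu>2"
  using assms const_level_iff[of 1]
  by (auto intro!: degenerateI distrib p0 simp: const_level_def)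

lemma pval_c_mod: "n > 0 \<Longrightarrow> pval p n c mod int p = int (c 0)"
  using pval_mod_le[OF p0, of 1 n c] c by (simp add: pval_Suc padic_units_def padic_def)

lemma c0: "0 < c 0" "c 0 < p"
  using c by (auto simp: padic_units_def padic_def)

lemma coprime_iff_mod: "coprime a (int p) \<longleftrightarrow> a mod int p \<noteq> 0"
  by (simp add: prime_coprime_int_iff[OF p] dvd_eq_mod_eq_0)

text \<open>Here \<open>?C - 1\<close> is divisible by \<open>p\<close>, while \<open>1 + ?C\<close>
  and \<open>2 * ?C\<close> are both 2 modulo \<open>p\<close>, hence units; so
  \<open>FG_equation1\<close> has the form required by \<open>heyde_all_one\<close>.\<close>

lemma degenerate_odd:
  assumes "p > 2" "c 0 = 1"
  shows "degenerate p \<mu>1" "degenerate p \<mu>2"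
proof -
  have "F n 1 = 1 \<and> G n 1 = 1" for n
  proof (cases "n = 0")
    case True
    then show ?thesis using FG_cong[of 1 0 n] FG_basic by (simp add: cong_def)
  next
    case False
    let ?C = "pval p n c"
    have m: "?C mod int p = 1" using False pval_c_mod assms by simp
    then have "(1 + ?C) mod int p = 2" "(2 * ?C) mod int p = 2"
      using assms(1) mod_add_right_eq[of 1 ?C "int p"] mod_mult_right_eq[of 2 ?C "int p"] by simp_all
    then have cop: "coprime (1 + ?C) (int p)" "coprime (2 * ?C) (int p)"
      by (simp_all only: coprime_iff_mod)
    have "int p dvd ?C - 1" using m assms by (simp add: mod_eq_dvd_iff[symmetric])
    then obtain t where t: "?C - 1 = int p * t" by blast
    have "F n 1 = 1" "G n 1 = 1"
      by (rule heyde_all_one[where F = "F n" and G = "G n" and t = t, OF p FG_cong FG_basic cop];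
          use FG_equation1[of n] t in \<open>simp add: mult.assoc\<close>)+
    then show ?thesis by simp
  qed
  then show "degenerate p \<mu>1" "degenerate p \<mu>2" using degenerate_of_norm_cf by auto
qed

text \<open>For \<open>p = 2\<close> all multipliers in \<open>FG_equation1\<close> are even. The
  equation is therefore taken one level up and a factor 2 is cancelled: with
  \<open>?C = 1 + 4 * t\<close> the multipliers become \<open>1 + 2 * t\<close>, \<open>?C\<close>
  and \<open>2 * t\<close>, of which the first two are odd.\<close>

lemma degenerate_even:
  assumes "p = 2" "c 0 = 1" "c 1 = 0"
  shows "degenerate p \<mu>1" "degenerate p \<mu>2"
proof -
  have "F n 1 = 1 \<and> G n 1 = 1" for n
  proof -
    let ?C = "pval p (Suc n) c"
    have "4 dvd ?C - 1"
    proof (cases n)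
      case (Suc k)
      have "pval p 2 c = 1" using assms by (simp add: pval_Suc numeral_2_eq_2)
      then show ?thesis using pval_diff_dvd[of 2 "Suc n" p c] Suc assms by simp
    qed (use assms in \<open>simp add: pval_Suc\<close>)
    then obtain t where t: "?C = 1 + 4 * t" by (metis dvd_def diff_add_cancel add.commute)
    have cop: "coprime (1 + 2 * t) (int p)" "coprime ?C (int p)"
      using assms t by (simp_all add: prime_coprime_int_iff[OF p])
    have eq: "F n ((1 + 2 * t) * b) * G n (?C * b) = F n (int p * (t * b))" for b
      using FG_equation1[of "Suc n" b] FG_lower[of n "(1 + 2 * t) * b"] FG_lower(2)[of n "?C * b"]
        FG_lower(1)[of n "int p * (t * b)"] t assms(1)
      by (simp add: algebra_simps)
    have "F n 1 = 1" "G n 1 = 1"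
      by (rule heyde_all_one[where F = "F n" and G = "G n" and t = t, OF p FG_cong FG_basic cop];
          use eq in simp)+
    then show ?thesis by simp
  qed
  then show "degenerate p \<mu>1" "degenerate p \<mu>2" using degenerate_of_norm_cf by auto
qed

text \<open>Since \<open>c 0\<close> is none of 0, 1 and \<open>p - 1\<close>, and \<open>p\<close>
  is odd, all multipliers are units. So both moduli take only the values 0 and 1, and they equal 1
  at the same reduced denominators.\<close>

lemma haar_case:
  assumes "p > 2" "c 0 \<noteq> p - 1" "c 0 \<noteq> 1"
  shows "\<exists>K \<nu>. is_haar p K \<nu> \<and> (\<exists>x1\<in>padic p. \<exists>x2\<in>padic p. \<mu>1 = shift p \<nu> x1 \<and> \<mu>2 = shift p \<nu> x2)"
proof -
  have cop: "coprime (1 + pval p n c) (int p ^ n)" "coprime (pval p n c - 1) (int p ^ n)"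
    "coprime (pval p n c) (int p ^ n)" "coprime 2 (int p ^ n)" for n
  proof -
    have "coprime (1 + pval p n c) (int p)" "coprime (pval p n c - 1) (int p)" "coprime (pval p n c) (int p)" "coprime 2 (int p)" if "n > 0"
      unfolding coprime_iff_mod
      using mod_add_right_eq[of 1 "pval p n c" "int p"] mod_diff_left_eq[of "pval p n c" "int p" 1]
        pval_c_mod[OF that] c0 assms by simp_all
    then show "coprime (1 + pval p n c) (int p ^ n)" "coprime (pval p n c - 1) (int p ^ n)"
      "coprime (pval p n c) (int p ^ n)" "coprime 2 (int p ^ n)"
      by (cases "n = 0"; simp)+
  qed
  note zo = heyde_zero_one[where F = "F n" and G = "G n" and N = "int p ^ n" for n,
      OF _ FG_cong FG_basic(1-4) cop FG_equation1 FG_equation2]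
  have N: "int p ^ n > 0" for n using p0 by simp
  have same: "const_level p \<mu>1 n \<longleftrightarrow> const_level p \<mu>2 n" for n
  proof (cases "n = 0")
    case True
    then show ?thesis unfolding const_level_def pval_0 by auto
  next
    case False
    \<comment> \<open>For positive \<open>n\<close>, the unit multiple provided by \<open>zo\<close>
      is a numerator prime to \<open>p\<close>, so its value again decides whether level
      \<open>n\<close> is constant.\<close>
    then have *: "coprime s (int p ^ n) \<longleftrightarrow> coprime s (int p)" for s by simp
    show ?thesis
      using zo(2)[OF N, of n 1] zo(3)[OF N, of n 1] const_level_iff[of 1 n] const_level_iff[of _ n]
      using False by (auto simp: *)
  qed
  show ?thesis
  proof (rule common_haar[OF p distrib same])
    fix n u assume u: "coprime u (int p)" "\<not> const_level p \<mu>1 n"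
    then have "F n u \<noteq> 1" "G n u \<noteq> 1" using const_level_iff same by blast+
    then have "F n u = 0" "G n u = 0" using zo(1)[OF N, of n u] zo(4)[OF N, of n u] by auto
    then show "cf p \<mu>1 n u = 0 \<and> cf p \<mu>2 n u = 0" by (simp add: F_def G_def)
  qed
qed

lemma haar_degenerate:
  assumes "degenerate p \<mu>1" "degenerate p \<mu>2"
  shows "\<exists>K \<nu>. is_haar p K \<nu> \<and> (\<exists>x1\<in>padic p. \<exists>x2\<in>padic p. \<mu>1 = shift p \<nu> x1 \<and> \<mu>2 = shift p \<nu> x2)"
  by (rule common_haar_of_degenerate[OF p0 assms])

end

subsection \<open>Counterexamples\<close>

text \<open>Fixing one event of a joint law turns it into a finite measure in the other variable, to
  which \<open>padic_measure_eqI\<close> applies.\<close>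

lemma restricted_distr:
  assumes M: "finite_measure M" and E: "E \<in> sets M" and X: "X \<in> measurable M borel"
  shows "finite_measure (distr (density M (indicator E)) borel X)"
    and "B \<in> sets borel \<Longrightarrow> emeasure (distr (density M (indicator E)) borel X) B = emeasure M (E \<inter> (X -` B \<inter> space M))"
proof -
  interpret finite_measure M by fact
  have X': "X \<in> measurable (density M (indicator E)) borel"
    using X by simp
  show em: "emeasure (distr (density M (indicator E)) borel X) B = emeasure M (E \<inter> (X -` B \<inter> space M))" if "B \<in> sets borel" for B
    using that E measurable_sets[OF X that] by (simp add: emeasure_distr[OF X'] emeasure_restricted)
  show "finite_measure (distr (density M (indicator E)) borel X)"
    by (rule finite_measureI) (use em[of UNIV] in \<open>simp add: emeasure_eq_measure\<close>)
qed

text \<open>Extends equality from residue classes to Borel sets one coordinate at a time: first in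
  \<open>L\<close> with a residue class of the second variable fixed, then in the second variable
  with the event \<open>L \<in> A\<close> fixed.\<close>

lemma joint_measure_eqI:
  assumes p: "p > 0" and M: "prob_space M"
    and L: "L \<in> measurable M borel" "\<And>\<omega>. \<omega> \<in> space M \<Longrightarrow> L \<omega> \<in> padic p"
    and Z: "Z \<in> measurable M borel" "\<And>\<omega>. \<omega> \<in> space M \<Longrightarrow> Z \<omega> \<in> padic p"
    and Z': "Z' \<in> measurable M borel" "\<And>\<omega>. \<omega> \<in> space M \<Longrightarrow> Z' \<omega> \<in> padic p"
    and eq: "\<And>n i l. measure M {\<omega> \<in> space M. pval p n (L \<omega>) = i \<and> pval p n (Z \<omega>) = l}
      = measure M {\<omega> \<in> space M. pval p n (L \<omega>) = i \<and> pval p n (Z' \<omega>) = l}"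
    and A: "A \<in> sets borel" and B: "B \<in> sets borel"
  shows "measure M (L -` A \<inter> space M \<inter> (Z -` B \<inter> space M)) = measure M (L -` A \<inter> space M \<inter> (Z' -` B \<inter> space M))"
proof -
  interpret prob_space M by fact
  have lev: "pval p n -` {i} \<in> sets borel" "{x. pval p n x = i} = pval p n -` {i}" for n i
    using measurable_sets[OF measurable_pval[of p n], of "{i}"] by (auto simp: space_borel)
  have two_levels: "emeasure M (L -` (pval p n -` {i}) \<inter> space M \<inter> (Z -` (pval p m -` {l}) \<inter> space M))
      = emeasure M (L -` (pval p n -` {i}) \<inter> space M \<inter> (Z' -` (pval p m -` {l}) \<inter> space M))" for n m i l
  proof -
    \<comment> \<open>The two coordinates are needed at independent levels; both are read off from a
      common higher one.\<close>
    define N where "N = max n m"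
    define S where "S = {(s, t). s mod int p ^ n = i \<and> t mod int p ^ m = l}"
    define J where "J W \<omega> = (pval p N (L \<omega>), pval p N (W \<omega> :: nat \<Rightarrow> nat))" for W \<omega>
    have J: "J W \<in> measurable M (count_space UNIV)" if "W \<in> measurable M borel" for W
      unfolding J_def
      by (intro measurable_count_space_binary[where h = Pair] measurable_compose[OF _ measurable_pval] that L)
    have Jeq: "L -` (pval p n -` {i}) \<inter> space M \<inter> (W -` (pval p m -` {l}) \<inter> space M) = J W -` S \<inter> space M" for W
      by (auto simp: J_def S_def N_def pval_mod_le p)
    have "J W -` {z} \<inter> space M = {\<omega> \<in> space M. pval p N (L \<omega>) = fst z \<and> pval p N (W \<omega>) = snd z}" for W z
      by (auto simp: J_def)
    then have "distr M (count_space UNIV) (J Z) = distr M (count_space UNIV) (J Z')"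
      by (intro measure_eqI_countable[where A = UNIV])
         (simp_all add: emeasure_distr J Z(1) Z'(1) emeasure_eq_measure eq)
    then have "emeasure (distr M (count_space UNIV) (J Z)) S = emeasure (distr M (count_space UNIV) (J Z')) S"
      by simp
    then show ?thesis
      by (simp add: Jeq emeasure_distr J Z(1) Z'(1))
  qed
  let ?R = "\<lambda>E X. distr (density M (indicator E)) borel X"
  have ae: "AE x in ?R E X. x \<in> padic p"
    if "X \<in> measurable M borel" "\<And>\<omega>. \<omega> \<in> space M \<Longrightarrow> X \<omega> \<in> padic p" for E X
    using that by (subst AE_distr_iff) (auto intro!: AE_I2)
  have one_level: "emeasure M (L -` A \<inter> space M \<inter> (Z -` (pval p m -` {l}) \<inter> space M))
      = emeasure M (L -` A \<inter> space M \<inter> (Z' -` (pval p m -` {l}) \<inter> space M))" for m l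
  proof -
    have E: "W -` (pval p m -` {l}) \<inter> space M \<in> sets M" if "W \<in> measurable M borel" for W
      using measurable_sets[OF that lev(1)] .
    have em: "emeasure (?R (W -` (pval p m -` {l}) \<inter> space M) L) X
        = emeasure M (L -` X \<inter> space M \<inter> (W -` (pval p m -` {l}) \<inter> space M))"
      if "W \<in> measurable M borel" "X \<in> sets borel" for W X
      by (subst restricted_distr(2)[OF finite_measure_axioms E[OF that(1)] L(1) that(2)]) (rule arg_cong[OF Int_commute])
    have "?R (Z -` (pval p m -` {l}) \<inter> space M) L = ?R (Z' -` (pval p m -` {l}) \<inter> space M) L"
    proof (rule padic_measure_eqI[OF p])
      show "finite_measure (?R (Z -` (pval p m -` {l}) \<inter> space M) L)"
        by (rule restricted_distr(1)[OF finite_measure_axioms E[OF Z(1)] L(1)])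
    qed (simp_all only: lev em[OF Z(1)] em[OF Z'(1)] two_levels, auto intro: ae L)
    from arg_cong[OF this, of "\<lambda>R. emeasure R A"] show ?thesis
      by (simp only: em[OF Z(1) A] em[OF Z'(1) A])
  qed
  have E: "L -` A \<inter> space M \<in> sets M" using measurable_sets[OF L(1) A] .
  have "?R (L -` A \<inter> space M) Z = ?R (L -` A \<inter> space M) Z'"
    by (rule padic_measure_eqI[OF p])
       (use one_level in \<open>simp_all add: restricted_distr finite_measure_axioms E Z Z' ae lev\<close>)
  from arg_cong[OF this, of "\<lambda>R. emeasure R B"] show ?thesis
    by (simp add: restricted_distr finite_measure_axioms E Z Z' B emeasure_eq_measure)
qed

section \<open>An involution on pairs of residues\<close>

text \<open>A matrix of trace 0 and determinant -1, hence an involution. It solves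
  \<open>j' + k' = j + k\<close> and \<open>j' + C * k' = - (j + C * k)\<close> with
  \<open>e\<close> standing for \<open>2 / (1 - C)\<close>.\<close>

definition swap_map :: "int \<Rightarrow> int \<Rightarrow> int \<times> int \<Rightarrow> int \<times> int" where
  "swap_map N e = (\<lambda>(j, k). (((1 - e) * j + (2 - e) * k) mod N, (e * j + (e - 1) * k) mod N))"

lemma swap_map_involution:
  assumes "0 \<le> j" "j < N" "0 \<le> k" "k < N"
  shows "swap_map N e (swap_map N e (j, k)) = (j, k)"
proof -
  have 1: "[(1 - e) * (((1 - e) * j + (2 - e) * k) mod N) + (2 - e) * ((e * j + (e - 1) * k) mod N)
      = (1 - e) * ((1 - e) * j + (2 - e) * k) + (2 - e) * (e * j + (e - 1) * k)] (mod N)"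
    by (intro cong_add cong_mult cong_refl) simp_all
  have 2: "[e * (((1 - e) * j + (2 - e) * k) mod N) + (e - 1) * ((e * j + (e - 1) * k) mod N)
      = e * ((1 - e) * j + (2 - e) * k) + (e - 1) * (e * j + (e - 1) * k)] (mod N)"
    by (intro cong_add cong_mult cong_refl) simp_all
  have "(1 - e) * ((1 - e) * j + (2 - e) * k) + (2 - e) * (e * j + (e - 1) * k) = j"
    "e * ((1 - e) * j + (2 - e) * k) + (e - 1) * (e * j + (e - 1) * k) = k"
    by (simp_all add: algebra_simps)
  with 1 2 show ?thesis using assms by (simp add: swap_map_def cong_def)
qed

lemma swap_map_sums:
  assumes e: "[e * (1 - C) = 2] (mod N)"
  shows "[fst (swap_map N e (j, k)) + snd (swap_map N e (j, k)) = j + k] (mod N)"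
    "[fst (swap_map N e (j, k)) + C * snd (swap_map N e (j, k)) = - (j + C * k)] (mod N)"
proof -
  have c: "[fst (swap_map N e (j, k)) = (1 - e) * j + (2 - e) * k] (mod N)"
    "[snd (swap_map N e (j, k)) = e * j + (e - 1) * k] (mod N)"
    by (simp_all add: swap_map_def)
  show "[fst (swap_map N e (j, k)) + snd (swap_map N e (j, k)) = j + k] (mod N)"
    using cong_add[OF c] by (simp add: algebra_simps)
  have "[fst (swap_map N e (j, k)) + C * snd (swap_map N e (j, k))
      = ((1 - e) * j + (2 - e) * k) + C * (e * j + (e - 1) * k)] (mod N)"
    by (intro cong_add cong_mult cong_refl c)
  \<comment> \<open>Regrouped so that \<open>e\<close> occurs only in the product
    \<open>e * (1 - C)\<close>.\<close>
  also have "((1 - e) * j + (2 - e) * k) + C * (e * j + (e - 1) * k)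
      = (j + k) - (e * (1 - C)) * (j + k) + (1 - C) * k"
    by (simp add: algebra_simps)
  also have "[(j + k) - (e * (1 - C)) * (j + k) + (1 - C) * k = (j + k) - 2 * (j + k) + (1 - C) * k] (mod N)"
    by (intro cong_add cong_diff cong_mult cong_refl e)
  also have "(j + k) - 2 * (j + k) + (1 - C) * k = - (j + C * k)"
    by (simp add: algebra_simps)
  finally show "[fst (swap_map N e (j, k)) + C * snd (swap_map N e (j, k)) = - (j + C * k)] (mod N)" .
qed

lemma swap_map_swaps:
  assumes e: "[e = 1] (mod int p)" and n: "0 \<le> j" "j < int p ^ n" "0 \<le> k" "k < int p ^ n"
  shows "[fst (swap_map (int p ^ n) e (j, k)) = k] (mod int p)"
    "[snd (swap_map (int p ^ n) e (j, k)) = j] (mod int p)"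
proof -
  have "[fst (swap_map (int p ^ n) e (j, k)) = k] (mod int p) \<and> [snd (swap_map (int p ^ n) e (j, k)) = j] (mod int p)"
  proof (cases "n = 0")
    case True
    then have "j = 0" "k = 0" using n by auto
    with True show ?thesis by (simp add: swap_map_def)
  next
    case False
    then have d: "int p dvd int p ^ n" by simp
    have "[(1 - e) * j + (2 - e) * k = (1 - 1) * j + (2 - 1) * k] (mod int p)"
      "[e * j + (e - 1) * k = 1 * j + (1 - 1) * k] (mod int p)"
      by (intro cong_add cong_mult cong_diff cong_refl e)+
    then show ?thesis by (simp add: swap_map_def cong_def mod_mod_cancel[OF d])
  qed
  then show "[fst (swap_map (int p ^ n) e (j, k)) = k] (mod int p)"
    "[snd (swap_map (int p ^ n) e (j, k)) = j] (mod int p)" by auto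
qed

text \<open>If \<open>p > 2\<close>, then \<open>1 - C\<close> is 2 modulo \<open>p\<close>, so the
  quotient \<open>2 / (1 - C)\<close> exists and is 1 modulo \<open>p\<close>. If
  \<open>p = 2\<close>, then \<open>C\<close> is 3 modulo 4, so \<open>1 - C\<close> is twice an odd
  number, whose inverse is odd.\<close>

lemma ex_swap_parameter:
  assumes p: "prime p" and c: "(p > 2 \<and> c 0 = p - 1) \<or> (p = 2 \<and> c 0 = 1 \<and> c 1 = 1)"
  shows "\<exists>e. [e * (1 - pval p n c) = 2] (mod int p ^ n) \<and> [e = 1] (mod int p)"
proof -
  have p0: "p > 0" using p prime_gt_0_nat by auto
  \<comment> \<open>Level \<open>n + 2\<close> keeps the digits \<open>c 0\<close> and
    \<open>c 1\<close> visible even for small \<open>n\<close>.\<close>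
  define C where "C = pval p (n + 2) c"
  have C: "[pval p n c = C] (mod int p ^ n)"
    using pval_mod_le[OF p0, of n "n + 2" c] p0 by (simp add: C_def cong_def)
  \<comment> \<open>The exponent \<open>n + 1\<close> is positive, so the congruence also holds
    modulo \<open>p\<close> when \<open>n = 0\<close>.\<close>
  have "\<exists>e. [e * (1 - C) = 2] (mod int p ^ (n + 1)) \<and> [e = 1] (mod int p)"
  proof (cases "p = 2")
    case False
    then have c0: "p > 2" "c 0 = p - 1" using c by auto
    have "int p dvd pval p (n + 2) c - pval p 1 c"
      using pval_diff_dvd[of 1 "n + 2" p c] by simp
    moreover have "pval p 1 c = int p - 1"
      using c0 by (simp add: pval_Suc of_nat_diff)
    ultimately have "int p dvd pval p (n + 2) c - (int p - 1)" by (simp only:)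
    also have "pval p (n + 2) c - (int p - 1) = C + 1 - int p" by (simp add: C_def)
    finally have "int p dvd C + 1 - int p" .
    then have dC: "int p dvd C + 1" using dvd_add[of "int p" "C + 1 - int p" "int p"] by simp
    then have two: "[1 - C = 2] (mod int p)"
      by (simp add: cong_iff_dvd_diff dvd_diff_commute algebra_simps)
    have cop2: "coprime 2 (int p)"
      using c0 prime_odd_nat[OF p] by simp
    then have "coprime (1 - C) (int p)" using two cong_imp_coprime cong_sym by blast
    then obtain h where h: "[(1 - C) * h = 1] (mod int p ^ (n + 1))"
      using cong_solve_coprime_int[of "1 - C" "int p ^ (n + 1)"] by auto
    from cong_mult[OF cong_refl h, of 2] have e: "[2 * h * (1 - C) = 2] (mod int p ^ (n + 1))"
      by (simp add: mult_ac)
    then have "[2 * h * (1 - C) = 2] (mod int p)"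
      by (rule cong_dvd_modulus) simp
    then have "[2 * h * 2 = 1 * 2] (mod int p)"
      using cong_trans[OF cong_mult[OF cong_refl cong_sym[OF two], of "2 * h"]] by simp
    then have "[2 * h = 1] (mod int p)"
      using cop2 by (simp only: cong_mult_rcancel)
    with e show ?thesis by blast
  next
    case True
    then have c0: "c 0 = 1" "c 1 = 1" using c by auto
    have "4 dvd pval p (n + 2) c - pval p 2 c"
      using pval_diff_dvd[of 2 "n + 2" p c] True by simp
    moreover have "pval p 2 c = 3"
      using c0 True by (simp add: pval_Suc numeral_2_eq_2)
    ultimately obtain t where t: "C - 3 = 4 * t" by (auto simp: C_def)
    define s where "s = - 1 - 2 * t"
    have s: "1 - C = 2 * s" using t by (simp add: s_def)
    have "coprime s (int p)" using True by (simp add: s_def)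
    then obtain h where h: "[s * h = 1] (mod int p ^ (n + 1))"
      using cong_solve_coprime_int[of s "int p ^ (n + 1)"] by auto
    from cong_mult[OF cong_refl h, of 2] have e: "[h * (1 - C) = 2] (mod int p ^ (n + 1))"
      by (simp add: s mult_ac)
    have "[s * h = 1] (mod int p)"
      using h by (rule cong_dvd_modulus) simp
    then have "odd (s * h)" using True by (simp add: cong_def flip: odd_iff_mod_2_eq_one)
    then have "[h = 1] (mod int p)" using True by (simp add: cong_def flip: odd_iff_mod_2_eq_one)
    with e show ?thesis by blast
  qed
  then obtain e where e: "[e * (1 - C) = 2] (mod int p ^ (n + 1))" "[e = 1] (mod int p)" by blast
  have "[e * (1 - pval p n c) = e * (1 - C)] (mod int p ^ n)"
    by (intro cong_mult cong_diff cong_refl C)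
  also have "[e * (1 - C) = 2] (mod int p ^ n)"
    using e(1) by (rule cong_dvd_modulus) simp
  finally show ?thesis using e(2) by blast
qed

text \<open>Reindex by the involution. It exchanges the two residues modulo \<open>p\<close>, and
  \<open>w\<close> depends only on these, so the product of weights is unchanged.\<close>

lemma swap_sum_eq:
  fixes w :: "int \<Rightarrow> real"
  assumes e: "[e * (1 - C) = 2] (mod int p ^ n)" "[e = 1] (mod int p)" and p: "p > 0"
    and w: "\<And>j j'. 0 \<le> j \<Longrightarrow> j < int p ^ n \<Longrightarrow> 0 \<le> j' \<Longrightarrow> j' < int p ^ n \<Longrightarrow> [j = j'] (mod int p) \<Longrightarrow> w j = w j'"
  defines "Q \<equiv> {0..<int p ^ n} \<times> {0..<int p ^ n}"
  shows "(\<Sum>(j, k) | (j, k) \<in> Q \<and> (j + k) mod int p ^ n = i \<and> (j + C * k) mod int p ^ n = l. w j * w k)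
    = (\<Sum>(j, k) | (j, k) \<in> Q \<and> (j + k) mod int p ^ n = i \<and> (- (j + C * k)) mod int p ^ n = l. w j * w k)"
proof -
  let ?N = "int p ^ n"
  let ?T = "swap_map ?N e"
  have N: "?N > 0" using p by simp
  have TQ: "?T z \<in> Q" for z
    using N by (cases z) (simp add: swap_map_def Q_def)
  have TT: "?T (?T z) = z" if "z \<in> Q" for z
    using that swap_map_involution by (cases z) (auto simp: Q_def)
  have wT: "w (fst (?T z)) * w (snd (?T z)) = w (fst z) * w (snd z)" if zQ: "z \<in> Q" for z
  proof -
    obtain j k where z: "z = (j, k)" "0 \<le> j" "j < ?N" "0 \<le> k" "k < ?N" using zQ by (auto simp: Q_def)
    have "w (fst (?T z)) = w k" "w (snd (?T z)) = w j"
      using TQ[of z] swap_map_swaps[OF e(2) z(2-5)] z by (auto intro!: w simp: Q_def)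
    then show ?thesis using z(1) by simp
  qed
  have sums: "(fst (?T z) + snd (?T z)) mod ?N = (fst z + snd z) mod ?N"
    "(fst (?T z) + C * snd (?T z)) mod ?N = (- (fst z + C * snd z)) mod ?N" for z
    using swap_map_sums[OF e(1), of "fst z" "snd z"] by (simp_all add: cong_def)
  have neg: "(- (fst (?T z) + C * snd (?T z))) mod ?N = (fst z + C * snd z) mod ?N" for z
    using sums(2)[of z] by (metis add.inverse_inverse mod_minus_eq)
  show ?thesis
    by (rule sum.reindex_bij_witness[where i = ?T and j = ?T])
       (use TQ TT wT sums neg in \<open>auto simp: case_prod_beta\<close>)
qed

text \<open>The leading digit is 0 with probability 2/3 and 1 with probability 1/3; this is neither
  degenerate nor invariant under a nonzero translation modulo \<^term>\<open>p\<close>.\<close>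

definition digit_law :: "nat \<Rightarrow> nat \<Rightarrow> nat pmf" where
  "digit_law p k = (if k = 0 then map_pmf of_bool (bernoulli_pmf (1 / 3)) else pmf_of_set {..<p})"

definition digits_measure :: "nat \<Rightarrow> (nat \<Rightarrow> nat) measure" where
  "digits_measure p = PiM UNIV (\<lambda>k. measure_pmf (digit_law p k))"

text \<open>\<open>rv\<close> demands values in \<open>padic p\<close> at every sample point,
  whereas samples of \<open>digits_measure p\<close> may have digits outside the range on a null
  set.\<close>

definition reduce :: "nat \<Rightarrow> (nat \<Rightarrow> nat) \<Rightarrow> (nat \<Rightarrow> nat)" where
  "reduce p x = (\<lambda>k. x k mod p)"

lemma prob_space_digits: "prob_space (digits_measure p)"
  unfolding digits_measure_def by (rule prob_space_PiM) unfold_locales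

lemma sets_digits [measurable_cong]: "sets (digits_measure p) = sets borel"
proof -
  have "sets (digits_measure p) = sets (PiM UNIV (\<lambda>_ :: nat. borel :: nat measure))"
    unfolding digits_measure_def by (intro sets_PiM_cong) (auto simp: sets_borel_eq_count_space)
  then show ?thesis by (simp add: sets_PiM_equal_borel)
qed

lemma space_digits: "space (digits_measure p) = UNIV"
  using sets_eq_imp_space_eq[OF sets_digits[of p]] by simp

lemma reduce_padic: "p > 0 \<Longrightarrow> reduce p x \<in> padic p"
  by (simp add: reduce_def padic_def)

lemma pval_reduce [simp]: "pval p n (reduce p x) = pval p n x"
  by (simp add: reduce_def pval_def)

lemma measurable_reduce [measurable]: "reduce p \<in> measurable borel borel"
proof (rule measurable_coordinatewise_then_product)
  fix i
  have "(\<lambda>x :: nat \<Rightarrow> nat. x i mod p) \<in> measurable borel (count_space UNIV)"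
    by (rule measurable_compose[OF measurable_digit]) simp
  then show "(\<lambda>x. reduce p x i) \<in> borel_measurable borel"
    by (simp add: reduce_def measurable_borel_iff_count_space)
qed

lemma measure_digits_cylinder:
  "measure (digits_measure p) {x. \<forall>k<n. x k mod p = a k} = (\<Prod>k<n. measure (digit_law p k) {t. t mod p = a k})"
proof -
  let ?M = "\<lambda>k. measure_pmf (digit_law p k)"
  let ?E = "prod_emb UNIV ?M {..<n} (Pi\<^sub>E {..<n} (\<lambda>k. {t. t mod p = a k}))"
  have "x \<in> ?E \<longleftrightarrow> (\<forall>k<n. x k mod p = a k)" for x
    by (simp add: prod_emb_def PiE_iff Ball_def)
  then have E: "{x. \<forall>k<n. x k mod p = a k} = ?E" by blast
  have "emeasure (PiM UNIV ?M) ?E = (\<Prod>k<n. emeasure (?M k) {t. t mod p = a k})"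
    by (rule emeasure_PiM_emb) (auto intro: measure_pmf.prob_space_axioms)
  also have "\<dots> = ennreal (\<Prod>k<n. measure (?M k) {t. t mod p = a k})"
    unfolding measure_pmf.emeasure_eq_measure by (rule prod_ennreal) simp
  finally show ?thesis
    unfolding E digits_measure_def by (rule measure_eq_emeasure_eq_ennreal[rotated]) (intro prod_nonneg ballI measure_nonneg)
qed

lemma digit_law_pos:
  assumes "k > 0" "d < p"
  shows "measure (digit_law p k) {t. t mod p = d} = 1 / real p"
proof -
  have "{..<p} \<inter> {t. t mod p = d} = {d}" using assms by auto
  moreover have "{..<p} \<noteq> {}" using assms by auto
  ultimately show ?thesis using assms by (simp add: digit_law_def measure_pmf_of_set)
qed

lemma digit_law_0:
  assumes "p > 1"
  shows "measure (digit_law p 0) {t. t mod p = d} = (if d = 0 then 2 / 3 else if d = 1 then 1 / 3 else 0)"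
proof -
  have "measure (digit_law p 0) {t. t mod p = d} = measure (bernoulli_pmf (1 / 3)) {b. of_bool b = d}"
    using assms by (auto simp: digit_law_def intro!: arg_cong[where f = "measure _"])
  also have "{b. of_bool b = d} = (if d = 0 then {False} else if d = 1 then {True} else {})"
    by (auto split: if_splits)
  also have "measure (bernoulli_pmf (1 / 3)) \<dots> = (if d = 0 then 2 / 3 else if d = 1 then 1 / 3 else 0)"
    by (simp add: measure_pmf_single)
  finally show ?thesis .
qed

text \<open>The mass of a residue class is a product over its digits. All factors after the first
  equal \<open>1 / p\<close>, and the leading digit is the residue modulo \<open>p\<close>.\<close>

lemma measure_level_cong:
  assumes p: "p > 0" and j: "0 \<le> j" "j < int p ^ n" "0 \<le> j'" "j' < int p ^ n" "[j = j'] (mod int p)"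
  shows "measure (digits_measure p) {x. pval p n x = j} = measure (digits_measure p) {x. pval p n x = j'}"
proof -
  have level: "measure (digits_measure p) {x. pval p n x = i}
      = (\<Prod>k<n. measure (digit_law p k) {t. t mod p = of_res p (\<lambda>_. i) k})" if "0 \<le> i" "i < int p ^ n" for i
  proof -
    \<comment> \<open>On a constant family \<open>of_res\<close> returns the base \<open>p\<close>
      digits of the integer.\<close>
    have "pval p n (of_res p (\<lambda>_. i)) = i"
      using pval_of_res[OF p, of "\<lambda>_. i"] that by simp
    then have "pval p n x = i \<longleftrightarrow> (\<forall>k<n. x k mod p = of_res p (\<lambda>_. i) k)" for x
      using pval_eq_iff[OF p, of n x "of_res p (\<lambda>_. i)"] of_res_padic[OF p, of "\<lambda>_. i"]
      by (simp add: padic_def)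
    then show ?thesis using measure_digits_cylinder[of p n] by simp
  qed
  have "measure (digit_law p k) {t. t mod p = of_res p (\<lambda>_. j) k} = measure (digit_law p k) {t. t mod p = of_res p (\<lambda>_. j') k}" for k
  proof (cases "k = 0")
    case True
    have "of_res p (\<lambda>_. j) 0 = of_res p (\<lambda>_. j') 0"
      using j(5) by (simp add: of_res_def cong_def)
    then show ?thesis using True by simp
  next
    case False
    then show ?thesis
      using of_res_padic[OF p] by (simp add: digit_law_pos padic_def)
  qed
  then show ?thesis using level j by simp
qed

lemma padd_digit_0: "p > 0 \<Longrightarrow> padd p x y 0 = (x 0 + y 0) mod p"
  by (simp add: padd_def of_res_def pval_Suc mod_simps flip: of_nat_add of_nat_mod)

text \<open>Compare leading digits. If some element of \<open>K\<close> has nonzero leading digit,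
  invariance gives that digit the same probability as 0; otherwise the leading digit is almost
  surely constant. Both contradict the values 2/3 and 1/3.\<close>

lemma not_idempotent:
  assumes p: "p > 1"
  shows "distr (digits_measure p) borel (reduce p) \<notin> idempotent_distrs p"
proof
  assume "distr (digits_measure p) borel (reduce p) \<in> idempotent_distrs p"
  then obtain K \<nu> x where K: "is_haar p K \<nu>" and eq: "distr (digits_measure p) borel (reduce p) = shift p \<nu> x"
    by (auto simp: idempotent_distrs_def)
  interpret \<nu>: prob_space \<nu> using K by (simp add: is_haar_def)
  have sets: "sets \<nu> = sets borel" and space: "space \<nu> = UNIV"
    using K by (auto simp: is_haar_def dest: sets_eq_imp_space_eq)
  have p0: "p > 0" using p by simp
  have digit_sets: "{y :: nat \<Rightarrow> nat. P (y 0)} \<in> sets borel" for P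
    using measurable_sets[OF measurable_digit[of 0], of "Collect P"] by (simp add: vimage_def)
  define D where "D d = measure \<nu> {y. (y 0 + x 0) mod p = d}" for d
  have D: "D d = (if d = 0 then 2 / 3 else if d = 1 then 1 / 3 else 0)" for d
  proof -
    have "(\<lambda>y. padd p y x) \<in> measurable \<nu> borel"
      by (subst measurable_cong_sets[OF sets refl]) measurable
    then have "D d = measure (shift p \<nu> x) {z. z 0 = d}"
      using digit_sets[of "\<lambda>t. t = d"] by (simp add: shift_def measure_distr D_def vimage_def padd_digit_0 p0 space)
    also have "\<dots> = measure (digits_measure p) {z. z 0 mod p = d}"
      unfolding eq[symmetric] using digit_sets[of "\<lambda>t. t = d"]
      by (subst measure_distr) (auto simp: space_digits vimage_def reduce_def cong: measurable_cong_sets)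
    also have "\<dots> = measure (digit_law p 0) {t. t mod p = d}"
      using measure_digits_cylinder[of p 1 "\<lambda>_. d"] by simp
    finally show ?thesis using digit_law_0[OF p] by simp
  qed
  show False
  proof (cases "\<exists>k\<in>K. k 0 \<noteq> 0")
    case True
    then obtain k where k: "k \<in> K" "k 0 \<noteq> 0" by auto
    then have "k 0 < p" using K by (auto simp: is_haar_def compact_subgroup_def padic_def)
    have inv: "distr \<nu> borel (padd p k) = \<nu>" using K k by (simp add: is_haar_def)
    have "padd p k \<in> measurable \<nu> borel"
      by (subst measurable_cong_sets[OF sets refl]) measurable
    then have "D (k 0) = measure \<nu> {y. ((k 0 + y 0) mod p + x 0) mod p = k 0}"
      unfolding D_def using digit_sets[of "\<lambda>t. (t + x 0) mod p = k 0"]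
      by (subst inv[symmetric]) (simp add: measure_distr vimage_def padd_digit_0 p0 space)
    \<comment> \<open>Translation by \<open>k\<close> carries the event for digit \<open>k 0\<close>
      to the event for digit 0.\<close>
    also have "((k 0 + t) mod p + x 0) mod p = k 0 \<longleftrightarrow> (t + x 0) mod p = 0" for t
    proof -
      have "((k 0 + t) mod p + x 0) mod p = (k 0 + (t + x 0)) mod p"
        by (simp add: mod_simps add.assoc)
      moreover have "k 0 = (k 0 + 0) mod p" using \<open>k 0 < p\<close> by simp
      ultimately have "((k 0 + t) mod p + x 0) mod p = k 0 \<longleftrightarrow> [k 0 + (t + x 0) = k 0 + 0] (mod p)"
        by (simp add: cong_def)
      also have "\<dots> \<longleftrightarrow> [t + x 0 = 0] (mod p)" by (rule cong_add_lcancel_nat)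
      finally show ?thesis by (simp add: cong_def)
    qed
    then have "measure \<nu> {y. ((k 0 + y 0) mod p + x 0) mod p = k 0} = D 0"
      by (simp add: D_def)
    finally show False using k(2) by (simp add: D split: if_splits)
  next
    case False
    have em: "emeasure \<nu> K = 1" using K by (simp add: is_haar_def)
    \<comment> \<open>\<open>emeasure\<close> is 0 on nonmeasurable sets, so mass 1 implies
      measurability.\<close>
    then have "K \<in> sets \<nu>" using emeasure_notin_sets[of K \<nu>] by auto
    then have "1 = measure \<nu> K" using em by (simp add: measure_def)
    also have "\<dots> \<le> D (x 0 mod p)"
      unfolding D_def using False digit_sets[of "\<lambda>t. (t + x 0) mod p = x 0 mod p"]
      by (intro \<nu>.finite_measure_mono) (auto simp: sets)
    finally show False by (simp add: D split: if_splits)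
  qed
qed

lemma (in prob_space) distr_pair_snd:
  assumes "prob_space N"
  shows "distr (M \<Otimes>\<^sub>M N) N snd = N"
proof (rule measure_eqI)
  interpret N: prob_space N by fact
  fix A assume A: "A \<in> sets (distr (M \<Otimes>\<^sub>M N) N snd)"
  then have "snd -` A \<inter> space (M \<Otimes>\<^sub>M N) = space M \<times> A"
    using sets.sets_into_space by (fastforce simp: space_pair_measure)
  with A show "emeasure (distr (M \<Otimes>\<^sub>M N) N snd) A = emeasure N A"
    by (simp add: emeasure_distr N.emeasure_pair_measure_Times emeasure_space_1)
qed simp

lemma indep_var_fst_snd:
  assumes "prob_space M" "prob_space N"
  shows "prob_space.indep_var (M \<Otimes>\<^sub>M N) M fst N snd"
proof -
  interpret M: prob_space M by fact
  interpret N: prob_space N by fact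
  interpret MN: pair_prob_space M N ..
  have "distr (M \<Otimes>\<^sub>M N) (M \<Otimes>\<^sub>M N) (\<lambda>x. (fst x, snd x)) = M \<Otimes>\<^sub>M N"
    using distr_id[of "M \<Otimes>\<^sub>M N"] by (simp add: id_def)
  then show ?thesis
    by (simp add: MN.indep_var_distribution_eq N.distr_pair_fst M.distr_pair_snd[OF assms(2)])
qed

text \<open>For two independent copies the residue pair \<open>(j, k)\<close> has weight
  \<open>w j * w k\<close>. The involution gives symmetry at each level, and
  \<open>joint_measure_eqI\<close> lifts it to Borel sets.\<close>

lemma counterexample:
  assumes p: "prime p" and c: "(p > 2 \<and> c 0 = p - 1) \<or> (p = 2 \<and> c 0 = 1 \<and> c 1 = 1)"
  defines "B \<equiv> digits_measure p"
  shows "setting p c (B \<Otimes>\<^sub>M B) (\<lambda>\<omega>. reduce p (fst \<omega>)) (\<lambda>\<omega>. reduce p (snd \<omega>))"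
proof -
  have p0: "p > 0" using p prime_gt_0_nat by auto
  interpret B: prob_space B unfolding B_def by (rule prob_space_digits)
  interpret BB: pair_prob_space B B ..
  let ?M = "B \<Otimes>\<^sub>M B"
  define X where "X \<omega> = reduce p (fst \<omega>)" for \<omega> :: "(nat \<Rightarrow> nat) \<times> (nat \<Rightarrow> nat)"
  define Y where "Y \<omega> = reduce p (snd \<omega>)" for \<omega> :: "(nat \<Rightarrow> nat) \<times> (nat \<Rightarrow> nat)"
  have sB [measurable_cong]: "sets B = sets borel" and spB: "space B = UNIV"
    by (simp_all add: B_def sets_digits space_digits)
  have X [measurable]: "X \<in> measurable ?M borel" and Y [measurable]: "Y \<in> measurable ?M borel"
    unfolding X_def[abs_def] Y_def[abs_def] by measurable
  have rv: "rv p ?M X" "rv p ?M Y"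
    using X Y by (auto simp: rv_def X_def Y_def reduce_padic p0)
  have redB: "reduce p \<in> measurable B borel" by measurable
  have indep: "BB.indep_var borel X borel Y"
    using BB.indep_var_compose[OF indep_var_fst_snd[OF B.prob_space_axioms B.prob_space_axioms] redB redB]
    by (simp add: comp_def X_def[abs_def] Y_def[abs_def])
  define L1 where "L1 \<omega> = padd p (X \<omega>) (Y \<omega>)" for \<omega>
  define L2 where "L2 \<omega> = padd p (X \<omega>) (pmul p c (Y \<omega>))" for \<omega>
  have L1 [measurable]: "L1 \<in> measurable ?M borel" and L2 [measurable]: "L2 \<in> measurable ?M borel"
    unfolding L1_def[abs_def] L2_def[abs_def] by measurable
  have nL2: "(\<lambda>\<omega>. pneg p (L2 \<omega>)) \<in> measurable ?M borel" by measurable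
  have levels: "measure ?M {\<omega> \<in> space ?M. pval p n (L1 \<omega>) = i \<and> pval p n (L2 \<omega>) = l}
      = measure ?M {\<omega> \<in> space ?M. pval p n (L1 \<omega>) = i \<and> pval p n (pneg p (L2 \<omega>)) = l}" for n i l
  proof -
    let ?N = "int p ^ n" and ?C = "pval p n c"
    define w where "w j = measure B {x. pval p n x = j}" for j
    define Q where "Q = {0..<?N} \<times> {0..<?N}"
    have N: "?N > 0" using p0 by simp
    have lev: "{x. pval p n x = j} \<in> sets B" for j
      using measurable_sets[OF measurable_pval[of p n], of "{j}"] by (simp add: vimage_def sB)
    define J where "J \<omega> = (pval p n (fst \<omega>), pval p n (snd \<omega>))" for \<omega>
    have J: "J \<in> measurable ?M (count_space UNIV)"
      unfolding J_def[abs_def] by (intro measurable_count_space_binary[where h = Pair]; measurable)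
    interpret D: prob_space "distr ?M (count_space UNIV) J"
      by (rule BB.prob_space_distr[OF J])
    \<comment> \<open>Only finitely many pairs of residues occur, so probabilities become finite
      sums.\<close>
    have JQ: "J \<omega> \<in> Q" for \<omega> using pval_bounds[OF p0] by (simp add: J_def Q_def)
    have single: "measure (distr ?M (count_space UNIV) J) {z} = w (fst z) * w (snd z)" for z
    proof -
      have "measure (distr ?M (count_space UNIV) J) {z} = measure ?M ({x. pval p n x = fst z} \<times> {x. pval p n x = snd z})"
        using J by (simp add: measure_distr) (auto simp: J_def space_pair_measure spB intro!: arg_cong[where f = "measure _"])
      then show ?thesis
        using lev by (simp add: measure_def w_def B.emeasure_pair_measure_Times enn2real_mult)
    qed
    have sum: "measure ?M {\<omega> \<in> space ?M. P (fst (J \<omega>)) (snd (J \<omega>))} = (\<Sum>(j, k) | (j, k) \<in> Q \<and> P j k. w j * w k)" for P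
    proof -
      let ?S = "{(j, k). (j, k) \<in> Q \<and> P j k}"
      have fin: "finite ?S" by (rule finite_subset[of _ Q]) (auto simp: Q_def)
      have "J -` ?S \<inter> space ?M = {\<omega> \<in> space ?M. P (fst (J \<omega>)) (snd (J \<omega>))}"
        using JQ by (auto simp: case_prod_beta)
      then have "measure ?M {\<omega> \<in> space ?M. P (fst (J \<omega>)) (snd (J \<omega>))} = measure (distr ?M (count_space UNIV) J) ?S"
        using J by (simp add: measure_distr)
      also have "\<dots> = (\<Sum>z\<in>?S. measure (distr ?M (count_space UNIV) J) {z})"
        using fin by (rule D.finite_measure_eq_sum_singleton) simp
      finally show ?thesis by (simp add: single case_prod_beta)
    qed
    have L1J: "pval p n (L1 \<omega>) = (fst (J \<omega>) + snd (J \<omega>)) mod ?N"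
      and L2J: "pval p n (L2 \<omega>) = (fst (J \<omega>) + ?C * snd (J \<omega>)) mod ?N"
      and nL2J: "pval p n (pneg p (L2 \<omega>)) = (- (fst (J \<omega>) + ?C * snd (J \<omega>))) mod ?N" for \<omega>
      by (simp_all add: L1_def L2_def J_def X_def Y_def pval_padd pval_pmul pval_pneg p0 mod_simps)
    obtain e where e: "[e * (1 - ?C) = 2] (mod ?N)" "[e = 1] (mod int p)"
      using ex_swap_parameter[OF p c] by blast
    have w_cong: "w j = w j'" if "0 \<le> j" "j < ?N" "0 \<le> j'" "j' < ?N" "[j = j'] (mod int p)" for j j'
      using measure_level_cong[OF p0 that] by (simp add: w_def B_def)
    show ?thesis
      unfolding L1J L2J nL2J
      using sum[of "\<lambda>j k. (j + k) mod ?N = i \<and> (j + ?C * k) mod ?N = l"]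
        sum[of "\<lambda>j k. (j + k) mod ?N = i \<and> (- (j + ?C * k)) mod ?N = l"]
        swap_sum_eq[where w = w, OF e p0 w_cong, of i l]
      by (simp only: Q_def)
  qed
  have "cond_symmetric p ?M L1 L2"
    unfolding cond_symmetric_iff[OF BB.prob_space_axioms L1 L2]
    by (intro ballI joint_measure_eqI[OF p0 BB.prob_space_axioms L1 _ L2 _ nL2 _ levels])
       (simp_all add: L1_def L2_def padd_padic pneg_padic p0)
  then have "setting p c ?M X Y"
    using rv indep BB.prob_space_axioms by (simp add: setting_def L1_def[abs_def] L2_def[abs_def])
  then show ?thesis by (simp add: X_def[abs_def] Y_def[abs_def])
qed

theorem theorem2:
  fixes p :: nat and c :: "nat \<Rightarrow> nat"
  assumes "prime p" and "c \<in> padic_units p"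
  shows
   "(\<forall>(M::'a measure) \<xi>1 \<xi>2. setting p c M \<xi>1 \<xi>2 \<longrightarrow>
       (let \<mu>1 = distr M borel \<xi>1; \<mu>2 = distr M borel \<xi>2 in
        (p > 2 \<and> c 0 \<noteq> p - 1 \<longrightarrow>
            (\<exists>K \<nu>. is_haar p K \<nu> \<and>
               (\<exists>x1\<in>padic p. \<exists>x2\<in>padic p. \<mu>1 = shift p \<nu> x1 \<and> \<mu>2 = shift p \<nu> x2))
          \<and> (c 0 = 1 \<longrightarrow> degenerate p \<mu>1 \<and> degenerate p \<mu>2))
      \<and> (p = 2 \<and> c 0 = 1 \<and> c 1 = 0 \<longrightarrow> degenerate p \<mu>1 \<and> degenerate p \<mu>2)))
    \<and>
    ((p > 2 \<and> c 0 = p - 1) \<or> (p = 2 \<and> c 0 = 1 \<and> c 1 = 1) \<longrightarrow>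
       (\<exists>(M::((nat \<Rightarrow> nat) \<times> (nat \<Rightarrow> nat)) measure) \<xi>1 \<xi>2. setting p c M \<xi>1 \<xi>2 \<and>
          distr M borel \<xi>1 \<notin> idempotent_distrs p \<and> distr M borel \<xi>2 \<notin> idempotent_distrs p))"
proof (intro conjI allI impI)
  fix M :: "'a measure" and X Y
  assume S: "setting p c M X Y"
  interpret heyde p c M X Y
    using assms S by unfold_locales
  show "let \<mu>1 = distr M borel X; \<mu>2 = distr M borel Y in
        (p > 2 \<and> c 0 \<noteq> p - 1 \<longrightarrow>
            (\<exists>K \<nu>. is_haar p K \<nu> \<and>
               (\<exists>x1\<in>padic p. \<exists>x2\<in>padic p. \<mu>1 = shift p \<nu> x1 \<and> \<mu>2 = shift p \<nu> x2))
          \<and> (c 0 = 1 \<longrightarrow> degenerate p \<mu>1 \<and> degenerate p \<mu>2))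
      \<and> (p = 2 \<and> c 0 = 1 \<and> c 1 = 0 \<longrightarrow> degenerate p \<mu>1 \<and> degenerate p \<mu>2)"
    unfolding Let_def \<mu>1_def[symmetric] \<mu>2_def[symmetric]
  proof (intro conjI impI)
    \<comment> \<open>The value \<open>c 0 = 1\<close>, excluded in \<open>haar_case\<close>, gives
      degenerate distributions, which are shifts of the point mass at zero.\<close>
    assume "p > 2 \<and> c 0 \<noteq> p - 1"
    then show "\<exists>K \<nu>. is_haar p K \<nu> \<and>
        (\<exists>x1\<in>padic p. \<exists>x2\<in>padic p. \<mu>1 = shift p \<nu> x1 \<and> \<mu>2 = shift p \<nu> x2)"
      using haar_case haar_degenerate[OF degenerate_odd] by (cases "c 0 = 1") auto
  qed (use degenerate_odd degenerate_even in auto)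
next
  assume c: "(p > 2 \<and> c 0 = p - 1) \<or> (p = 2 \<and> c 0 = 1 \<and> c 1 = 1)"
  let ?B = "digits_measure p"
  interpret B: prob_space ?B by (rule prob_space_digits)
  \<comment> \<open>Both laws factor through a marginal of the product, which is \<open>?B\<close>
    itself.\<close>
  have "distr (?B \<Otimes>\<^sub>M ?B) borel (\<lambda>\<omega>. reduce p (fst \<omega>)) = distr (distr (?B \<Otimes>\<^sub>M ?B) ?B fst) borel (reduce p)"
    "distr (?B \<Otimes>\<^sub>M ?B) borel (\<lambda>\<omega>. reduce p (snd \<omega>)) = distr (distr (?B \<Otimes>\<^sub>M ?B) ?B snd) borel (reduce p)"
    by (subst distr_distr; simp add: comp_def cong: measurable_cong_sets)+
  then have "distr (?B \<Otimes>\<^sub>M ?B) borel (\<lambda>\<omega>. reduce p (fst \<omega>)) \<notin> idempotent_distrs p"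
    "distr (?B \<Otimes>\<^sub>M ?B) borel (\<lambda>\<omega>. reduce p (snd \<omega>)) \<notin> idempotent_distrs p"
    using not_idempotent[of p] prime_gt_1_nat[OF assms(1)]
    by (simp_all add: B.distr_pair_fst B.distr_pair_snd[OF B.prob_space_axioms])
  then show "\<exists>(M::((nat \<Rightarrow> nat) \<times> (nat \<Rightarrow> nat)) measure) \<xi>1 \<xi>2. setting p c M \<xi>1 \<xi>2 \<and>
          distr M borel \<xi>1 \<notin> idempotent_distrs p \<and> distr M borel \<xi>2 \<notin> idempotent_distrs p"
    using counterexample[OF assms(1) c] by blast
qed

end
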